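(* Let $p>1$ and let $T$ be a linear operator (acting on locally integrable functions on $\mathbb{R}^n$) which is non-degenerate and bounded on $L^p(\mathbb{R}^n)$. Let $w\in N_p$ be a weight positive on a set of positive measure. If $T$ is bounded on $ML^p(w)$, that is, there is $C>0$ with $$\|M(Tf)\|_{L^p(w)}\le C\|Mf\|_{L^p(w)}\quad\text{for all } f\in ML^p(w),$$ then $w\in A_p$.
   Context: $T$ is non-degenerate if there is $C>0$ such that for every $\ell>0$ there is $x_\ell\in\mathbb{R}^n$ with the following property: for all cubes $Q$ of side length $\ell$, all non-negative locally integrable $f$, and all $x\in(Q+x_\ell)\cup(Q-x_\ell)$, $$\frac1{|Q|}\int_Q f\le C|T(f\chi_Q)(x)|.$$ $Mf(x)=\sup_{Q\ni x}\frac1{|Q|}\int_Q|f|$ is the Hardy–Littlewood maximal operator, with the supremum over cubes containing $x$. A weight is a non-negative locally integrable function. $N_p$ is the class of weights with $\int w(x)(1+|x|)^{-np}\,dx<\infty$. $A_p$ is the class of weights with $$\sup_Q\Big(\frac1{|Q|}\int_Q w\Big)\Big(\frac1{|Q|}\int_Q w^{-1/(p-1)}\Big)^{p-1}<\infty.$$ $ML^p(w)$ is the space of measurable $f$ with $\|f\|_{ML^p(w)}:=\|Mf\|_{L^p(w)}<\infty$. *)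

theory Defs
  imports "HOL-Analysis.Analysis"
begin

definition cube :: "'a::euclidean_space \<Rightarrow> real \<Rightarrow> 'a set" where
  "cube a l = cbox a (a + l *\<^sub>R One)"

definition loc_integrable :: "('a::euclidean_space \<Rightarrow> real) \<Rightarrow> bool" where
  "loc_integrable f \<longleftrightarrow> f \<in> borel_measurable lebesgue \<and>
     (\<forall>K. compact K \<longrightarrow> set_integrable lebesgue K f)"

definition epowr :: "ennreal \<Rightarrow> real \<Rightarrow> ennreal" where
  "epowr x q = (if x = \<infinity> then \<infinity> else ennreal (enn2real x powr q))"

definition maximal :: "('a::euclidean_space \<Rightarrow> real) \<Rightarrow> 'a \<Rightarrow> ennreal" where
  "maximal f x = (SUP (a, l) \<in> {(a, l). l > 0 \<and> x \<in> cube a l}.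
       ennreal (1 / l ^ DIM('a)) * (\<integral>\<^sup>+ y \<in> cube a l. ennreal \<bar>f y\<bar> \<partial>lebesgue))"

definition Lp_pow :: "real \<Rightarrow> ('a::euclidean_space \<Rightarrow> real) \<Rightarrow> ennreal" where
  "Lp_pow p f = (\<integral>\<^sup>+ x. ennreal (\<bar>f x\<bar> powr p) \<partial>lebesgue)"

definition in_Lp :: "real \<Rightarrow> ('a::euclidean_space \<Rightarrow> real) \<Rightarrow> bool" where
  "in_Lp p f \<longleftrightarrow> f \<in> borel_measurable lebesgue \<and> Lp_pow p f < \<infinity>"

definition MLp_pow :: "real \<Rightarrow> ('a::euclidean_space \<Rightarrow> real) \<Rightarrow> ('a \<Rightarrow> real) \<Rightarrow> ennreal" where
  "MLp_pow p w f = (\<integral>\<^sup>+ x. epowr (maximal f x) p * ennreal (w x) \<partial>lebesgue)"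

definition in_MLp :: "real \<Rightarrow> ('a::euclidean_space \<Rightarrow> real) \<Rightarrow> ('a \<Rightarrow> real) \<Rightarrow> bool" where
  "in_MLp p w f \<longleftrightarrow> f \<in> borel_measurable lebesgue \<and> MLp_pow p w f < \<infinity>"

definition is_weight :: "('a::euclidean_space \<Rightarrow> real) \<Rightarrow> bool" where
  "is_weight w \<longleftrightarrow> (\<forall>x. w x \<ge> 0) \<and> loc_integrable w"

definition in_Np :: "real \<Rightarrow> ('a::euclidean_space \<Rightarrow> real) \<Rightarrow> bool" where
  "in_Np p w \<longleftrightarrow> is_weight w \<and>
     (\<integral>\<^sup>+ x. ennreal (w x * (1 + norm x) powr (- (real DIM('a) * p))) \<partial>lebesgue) < \<infinity>"

definition dual_weight :: "real \<Rightarrow> ('a \<Rightarrow> real) \<Rightarrow> 'a \<Rightarrow> ennreal" where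
  "dual_weight p w x = (if w x = 0 then \<infinity> else ennreal (w x powr (- 1 / (p - 1))))"

text \<open>Muckenhoupt A_p: the supremum over all cubes is finite (in particular each
  term is finite).\<close>
definition in_Ap :: "real \<Rightarrow> ('a::euclidean_space \<Rightarrow> real) \<Rightarrow> bool" where
  "in_Ap p w \<longleftrightarrow> is_weight w \<and> (\<exists>K::real. \<forall>a l. l > 0 \<longrightarrow>
     (\<integral>\<^sup>+ y \<in> cube a l. dual_weight p w y \<partial>lebesgue) < \<infinity> \<and>
     ((LINT y:cube a l|lebesgue. w y) / l ^ DIM('a)) *
     (enn2real (\<integral>\<^sup>+ y \<in> cube a l. dual_weight p w y \<partial>lebesgue) / l ^ DIM('a)) powr (p - 1)
       \<le> K)"

definition non_degenerate :: "(('a::euclidean_space \<Rightarrow> real) \<Rightarrow> ('a \<Rightarrow> real)) \<Rightarrow> bool" where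
  "non_degenerate T \<longleftrightarrow> (\<exists>C>0. \<forall>l>0. \<exists>xl. \<forall>a f x.
     loc_integrable f \<longrightarrow> (\<forall>y. f y \<ge> 0) \<longrightarrow>
     x \<in> ((\<lambda>y. y + xl) ` cube a l) \<union> ((\<lambda>y. y - xl) ` cube a l) \<longrightarrow>
     (LINT y:cube a l|lebesgue. f y) / l ^ DIM('a)
       \<le> C * \<bar>T (\<lambda>y. indicator (cube a l) y * f y) x\<bar>)"

definition linear_op :: "(('a::euclidean_space \<Rightarrow> real) \<Rightarrow> ('a \<Rightarrow> real)) \<Rightarrow> bool" where
  "linear_op T \<longleftrightarrow> (\<forall>f g. loc_integrable f \<longrightarrow> loc_integrable g \<longrightarrow>
       T (\<lambda>x. f x + g x) = (\<lambda>x. T f x + T g x)) \<and>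
     (\<forall>f c. loc_integrable f \<longrightarrow> T (\<lambda>x. c * f x) = (\<lambda>x. c * T f x))"

definition Lp_bounded :: "real \<Rightarrow> (('a::euclidean_space \<Rightarrow> real) \<Rightarrow> ('a \<Rightarrow> real)) \<Rightarrow> bool" where
  "Lp_bounded p T \<longleftrightarrow> (\<exists>C::real. C > 0 \<and> (\<forall>f. in_Lp p f \<longrightarrow>
      T f \<in> borel_measurable lebesgue \<and> Lp_pow p (T f) \<le> ennreal C * Lp_pow p f))"

end

theory Submission
  imports Defs
begin

text \<open>
  Testing non-degeneracy on \<open>f\<close> supported in \<open>Q\<close> moves the average of \<open>f\<close> to \<open>Q \<plusminus> x\<^sub>l\<close>, and a second
  application of \<open>T\<close> moves it back to \<open>Q\<close>. Concentrate the mass of \<open>f\<close> in each cell of a fine grid in a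
  subcube that is \<open>4\<^sup>N\<close> times smaller than the cell, and apply this round trip at \<open>N\<close> scales at once, with
  random signs to exclude cancellation: every scale returns a mass comparable to the original one, so
  the result has averages \<open>N\<close> times those of \<open>f\<close>. The two applications of \<open>T\<close> cost a constant that does not
  depend on \<open>N\<close>, whereas concentrating the mass adds to the norm of \<open>Mf\<close> only a term bounded, in the limit
  of fine grids, by a multiple of the \<open>L\<^sup>p(w)\<close> norm of \<open>f\<close>. For \<open>N\<close> large the norm of \<open>Mf\<close> is absorbed, and
  \<open>M\<close> is bounded on \<open>L\<^sup>p(w)\<close>. Testing this on \<open>(w + 1/j)\<close> to the power \<open>-1/(p-1)\<close> on a cube gives the
  \<open>A\<^sub>p\<close> condition.
\<close>

section \<open>Cubes and the maximal function\<close>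

text \<open>The hypothesis on \<open>T\<close> has maximal functions on both sides, whereas A_p
  requires averages of \<open>f\<close> to be bounded by the norm of \<open>f\<close> itself. That
  norm enters through cubes smaller than the mesh, where averages of \<open>f\<close> are close to
  values of \<open>f\<close>; larger cubes must be paid for by a gain that grows with
  \<open>N\<close> at a fixed cost. Two facts give such a gain. On the way out, a density on one
  tiny cube lies in all larger cubes with the same corner, so a single application of
  \<open>T\<close> is large on the translates at all \<open>N\<close> scales. Once overlaps are
  removed these translates are disjoint, and the density to be sent back stays below a constant
  multiple of a function already controlled, without a factor \<open>N\<close>. On the way back one
  function majorizes all \<open>N\<close> returns, so near the corner it is at least of the size
  |x|^(-n) times the mass; its integrals over \<open>N\<close> disjoint annuli are comparable, which
  is the logarithmic divergence of |x|^(-n). Concentration multiplies densities by 4^(N n). This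
  large constant is harmless because it appears only in front of the term for cubes below the mesh,
  never in front of \<open>Mf\<close>.\<close>

lemma epowr_ennreal [simp]: "0 \<le> x \<Longrightarrow> epowr (ennreal x) p = ennreal (x powr p)"
  by (simp add: epowr_def)

lemma epowr_top [simp]: "epowr top p = top"
  by (simp add: epowr_def)

lemma epowr_mono:
  assumes "x \<le> y" "0 \<le> p"
  shows "epowr x p \<le> epowr y p"
  using assms by (cases x; cases y) (auto simp: ennreal_leI powr_mono2 top_unique)

lemma epowr_mult:
  assumes "0 < c"
  shows "epowr (ennreal c * x) p = ennreal (c powr p) * epowr x p"
proof (cases x)
  case (real r)
  then show ?thesis
    using assms by (simp add: ennreal_mult[symmetric] powr_mult)
next
  case top
  then show ?thesis
    using assms by (simp add: ennreal_mult_top)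
qed

lemma powr_midpoint_le:
  fixes a b p :: real
  assumes "0 \<le> a" "0 \<le> b" "1 \<le> p"
  shows "((a + b) / 2) powr p \<le> (a powr p + b powr p) / 2"
proof -
  \<comment> \<open>This settles the cases in which \<open>a\<close> or \<open>b\<close> vanishes;
    convexity is used on the open half-line.\<close>
  have half: "(c / 2) powr p \<le> c powr p / 2" if "0 \<le> c" for c :: real
  proof -
    have "(1 / 2 :: real) powr p \<le> (1 / 2) powr 1"
      using assms by (intro powr_mono') auto
    then have "c powr p * (1 / 2) powr p \<le> c powr p * (1 / 2)"
      by (intro mult_left_mono) auto
    then show ?thesis
      by (simp add: powr_divide)
  qed
  consider "a = 0" | "b = 0" | "0 < a" "0 < b"
    using assms by linarith
  then show ?thesis
  proof cases
    case 3
    then have "((1 - 1/2) *\<^sub>R a + (1/2) *\<^sub>R b) powr p \<le> (1 - 1/2) * a powr p + (1/2) * b powr p"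
      by (intro convex_onD[OF powr_convex[OF assms(3)]]) auto
    then show ?thesis
      by (simp add: field_simps)
  qed (use half assms in auto)
qed

lemma ennreal_half: "0 \<le> r \<Longrightarrow> ennreal (1/2) * ennreal r = ennreal (r / 2)"
  by (subst ennreal_mult[symmetric]) auto

lemma epowr_midpoint_le:
  assumes "1 \<le> p"
  shows "epowr (ennreal (1/2) * (x + y)) p \<le> ennreal (1/2) * (epowr x p + epowr y p)"
proof (cases x)
  case x: (real a)
  show ?thesis
  proof (cases y)
    case (real b)
    have "ennreal (1/2) * (x + y) = ennreal ((a + b) / 2)"
      unfolding ennreal_half[symmetric, OF add_nonneg_nonneg[OF x(1) real(1)]] using x real by simp
    moreover have "ennreal (1/2) * (epowr x p + epowr y p) = ennreal ((a powr p + b powr p) / 2)"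
      using x real ennreal_half[of "a powr p + b powr p"] by simp
    ultimately show ?thesis
      using powr_midpoint_le[of a b p] x real assms by (simp add: ennreal_leI)
  next
    case top
    then show ?thesis by (simp add: ennreal_mult_top)
  qed
next
  case top
  then show ?thesis by (simp add: ennreal_mult_top)
qed

lemma epowr_add_le:
  assumes "1 \<le> p"
  shows "epowr (x + y) p \<le> ennreal (2 powr p) * (epowr x p + epowr y p)"
proof -
  have "epowr (x + y) p = epowr (ennreal 2 * (ennreal (1/2) * (x + y))) p"
    by (subst mult.assoc[symmetric], subst ennreal_mult[symmetric]) auto
  also have "\<dots> = ennreal (2 powr p) * epowr (ennreal (1/2) * (x + y)) p"
    by (rule epowr_mult) simp
  also have "\<dots> \<le> ennreal (2 powr p) * (ennreal (1/2) * (epowr x p + epowr y p))"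
    by (intro mult_left_mono epowr_midpoint_le assms) simp
  also have "\<dots> \<le> ennreal (2 powr p) * (1 * (epowr x p + epowr y p))"
    by (intro mult_left_mono mult_right_mono) (subst ennreal_le_1, auto)
  finally show ?thesis by simp
qed

lemma borel_measurable_epowr [measurable]: "(\<lambda>x. epowr x p) \<in> borel_measurable borel"
  unfolding epowr_def by measurable

section \<open>Cubes, averages over cubes and the maximal function\<close>

lemma mem_cube: "x \<in> cube a l \<longleftrightarrow> (\<forall>i\<in>Basis. a \<bullet> i \<le> x \<bullet> i \<and> x \<bullet> i \<le> a \<bullet> i + l)"
  by (auto simp: cube_def mem_box inner_simps)

lemma cube_in_lebesgue [simp, measurable]: "cube a l \<in> sets lebesgue"
  by (simp add: cube_def)

lemma compact_cube: "compact (cube a l)"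
  by (simp add: cube_def)

lemma bounded_cube: "bounded (cube a l)"
  by (simp add: cube_def)

lemma emeasure_cube:
  fixes a :: "'a::euclidean_space"
  assumes "0 \<le> l"
  shows "emeasure lebesgue (cube a l) = ennreal (l ^ DIM('a))"
proof -
  have "\<forall>b\<in>Basis. a \<bullet> b \<le> (a + l *\<^sub>R One) \<bullet> b"
    using assms by (auto simp: inner_simps)
  then have "emeasure lborel (cube a l) = ennreal (l ^ DIM('a))"
    unfolding cube_def emeasure_lborel_cbox_eq using assms by (simp add: inner_simps)
  moreover have "emeasure lebesgue (cube a l) = emeasure lborel (cube a l)"
    unfolding cube_def by simp
  ultimately show ?thesis by simp
qed

lemma measure_cube:
  fixes a :: "'a::euclidean_space"
  assumes "0 \<le> l"
  shows "measure lebesgue (cube a l) = l ^ DIM('a)"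
  using emeasure_cube[OF assms, of a] assms by (simp add: measure_def)

lemma cube_mono: "l \<le> l' \<Longrightarrow> cube a l \<subseteq> cube a l'"
  by (fastforce simp: mem_cube)

lemma cube_translate: "(\<lambda>y. y + v) ` cube a l = cube (a + v) l"
proof -
  have "x \<in> cube (a + v) l \<Longrightarrow> x - v \<in> cube a l" for x
    by (auto simp: mem_cube inner_simps algebra_simps)
  then show ?thesis
    by (force simp: mem_cube inner_simps algebra_simps image_iff intro: bexI[where x="x - v" for x])
qed

definition cube_avg :: "('a::euclidean_space \<Rightarrow> real) \<Rightarrow> 'a \<Rightarrow> real \<Rightarrow> ennreal" where
  "cube_avg f a l = ennreal (1 / l ^ DIM('a)) * (\<integral>\<^sup>+ y \<in> cube a l. ennreal \<bar>f y\<bar> \<partial>lebesgue)"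

lemma cube_avg_le_maximal: "0 < l \<Longrightarrow> x \<in> cube a l \<Longrightarrow> cube_avg f a l \<le> maximal f x"
  unfolding maximal_def cube_avg_def by (rule SUP_upper2[where i="(a, l)"]) auto

lemma maximal_leI:
  assumes "\<And>a l. 0 < l \<Longrightarrow> x \<in> cube a l \<Longrightarrow> cube_avg f a l \<le> K"
  shows "maximal f x \<le> K"
  unfolding maximal_def using assms by (intro SUP_least) (auto simp: cube_avg_def)

lemma less_maximal_iff: "t < maximal f x \<longleftrightarrow> (\<exists>a l. 0 < l \<and> x \<in> cube a l \<and> t < cube_avg f a l)"
  unfolding maximal_def less_SUP_iff cube_avg_def by auto

lemma cube_avg_mono:
  assumes "\<And>x. x \<in> cube a l \<Longrightarrow> \<bar>f x\<bar> \<le> \<bar>g x\<bar>"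
  shows "cube_avg f a l \<le> cube_avg g a l"
  unfolding cube_avg_def
  by (intro mult_left_mono nn_integral_mono) (auto split: split_indicator intro!: ennreal_leI assms)

lemma maximal_mono:
  assumes "\<And>x. \<bar>f x\<bar> \<le> \<bar>g x\<bar>"
  shows "maximal f x \<le> maximal g x"
proof (rule maximal_leI)
  fix a l assume "0 < l" "x \<in> cube a l"
  then show "cube_avg f a l \<le> maximal g x"
    using cube_avg_mono[of a l f g] cube_avg_le_maximal[of l x a g] assms by (meson order_trans)
qed

lemma nn_integral_cube_const:
  fixes a :: "'a::euclidean_space"
  assumes "0 < l"
  shows "ennreal (1 / l ^ DIM('a)) * (\<integral>\<^sup>+ y \<in> cube a l. K \<partial>lebesgue) = K"
proof -
  have "(\<integral>\<^sup>+ y \<in> cube a l. K \<partial>lebesgue) = K * ennreal (l ^ DIM('a))"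
    using assms by (subst nn_integral_cmult_indicator) (simp_all only: emeasure_cube cube_in_lebesgue less_imp_le)
  then have "ennreal (1 / l ^ DIM('a)) * (\<integral>\<^sup>+ y \<in> cube a l. K \<partial>lebesgue)
      = K * (ennreal (1 / l ^ DIM('a)) * ennreal (l ^ DIM('a)))"
    by (simp add: ac_simps)
  also have "ennreal (1 / l ^ DIM('a)) * ennreal (l ^ DIM('a)) = 1"
    using assms by (simp add: ennreal_mult[symmetric] del: ennreal_mult)
  finally show ?thesis by simp
qed

lemma cube_avg_le_const:
  assumes "0 < l" "\<And>x. x \<in> cube a l \<Longrightarrow> \<bar>f x\<bar> \<le> K"
  shows "cube_avg f a l \<le> ennreal K"
proof -
  have "cube_avg f a l \<le> ennreal (1 / l ^ DIM('a)) * (\<integral>\<^sup>+ y \<in> cube a l. ennreal K \<partial>lebesgue)"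
    unfolding cube_avg_def
    by (intro mult_left_mono nn_integral_mono) (auto split: split_indicator intro!: ennreal_leI assms)
  then show ?thesis
    using nn_integral_cube_const[OF assms(1), where a=a and K="ennreal K"] by simp
qed

lemma maximal_mult:
  assumes [measurable]: "f \<in> borel_measurable lebesgue" and "0 < c"
  shows "maximal (\<lambda>x. c * f x) x = ennreal c * maximal f x"
proof -
  have "cube_avg (\<lambda>x. c * f x) a l = ennreal c * cube_avg f a l" for a l
  proof -
    have "(\<integral>\<^sup>+ y \<in> cube a l. ennreal \<bar>c * f y\<bar> \<partial>lebesgue) = (\<integral>\<^sup>+ y. ennreal c * (ennreal \<bar>f y\<bar> * indicator (cube a l) y) \<partial>lebesgue)"
      using assms by (intro nn_integral_cong) (simp add: abs_mult ennreal_mult ac_simps)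
    also have "\<dots> = ennreal c * (\<integral>\<^sup>+ y \<in> cube a l. ennreal \<bar>f y\<bar> \<partial>lebesgue)"
      by (rule nn_integral_cmult) measurable
    finally show ?thesis
      unfolding cube_avg_def by (simp add: ac_simps)
  qed
  then show ?thesis
    unfolding maximal_def cube_avg_def[symmetric]
    by (subst SUP_mult_left_ennreal) (auto intro!: SUP_cong)
qed

lemma maximal_midpoint_le:
  assumes [measurable]: "f \<in> borel_measurable lebesgue" "g \<in> borel_measurable lebesgue"
  shows "maximal (\<lambda>x. (f x + g x) / 2) x \<le> ennreal (1/2) * (maximal f x + maximal g x)"
proof (rule maximal_leI)
  fix a :: 'a and l :: real assume al: "0 < l" "x \<in> cube a l"
  have "(\<integral>\<^sup>+ y \<in> cube a l. ennreal \<bar>(f y + g y) / 2\<bar> \<partial>lebesgue)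
     \<le> (\<integral>\<^sup>+ y. ennreal (1/2) * (ennreal \<bar>f y\<bar> * indicator (cube a l) y + ennreal \<bar>g y\<bar> * indicator (cube a l) y) \<partial>lebesgue)"
  proof (intro nn_integral_mono)
    fix y
    have "ennreal \<bar>(f y + g y) / 2\<bar> \<le> ennreal ((1/2) * (\<bar>f y\<bar> + \<bar>g y\<bar>))"
      by (intro ennreal_leI) (simp add: abs_triangle_ineq)
    also have "\<dots> = ennreal (1/2) * (ennreal \<bar>f y\<bar> + ennreal \<bar>g y\<bar>)"
      using ennreal_half[of "\<bar>f y\<bar> + \<bar>g y\<bar>"] by simp
    finally show "ennreal \<bar>(f y + g y) / 2\<bar> * indicator (cube a l) y
        \<le> ennreal (1/2) * (ennreal \<bar>f y\<bar> * indicator (cube a l) y + ennreal \<bar>g y\<bar> * indicator (cube a l) y)"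
      by (auto split: split_indicator)
  qed
  also have "\<dots> = ennreal (1/2) * ((\<integral>\<^sup>+ y \<in> cube a l. ennreal \<bar>f y\<bar> \<partial>lebesgue) + (\<integral>\<^sup>+ y \<in> cube a l. ennreal \<bar>g y\<bar> \<partial>lebesgue))"
    by (subst nn_integral_cmult, measurable, subst nn_integral_add, measurable)
  finally have "cube_avg (\<lambda>x. (f x + g x) / 2) a l \<le> ennreal (1 / l ^ DIM('a)) * \<dots>"
    unfolding cube_avg_def by (intro mult_left_mono) auto
  also have "\<dots> = ennreal (1/2) * (cube_avg f a l + cube_avg g a l)"
    unfolding cube_avg_def by (simp add: algebra_simps)
  also have "\<dots> \<le> ennreal (1/2) * (maximal f x + maximal g x)"
    by (intro mult_left_mono add_mono cube_avg_le_maximal al) auto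
  finally show "cube_avg (\<lambda>x. (f x + g x) / 2) a l \<le> \<dots>" .
qed

text \<open>Replacing the side \<open>l\<close> by a side at most \<open>r * l\<close> changes the
  normalizing factor by at most r^n. The cubes need not be nested and the masses may belong to
  different functions; the free factor \<open>K\<close> later carries the gain 1/N.\<close>

lemma cube_avg_compare:
  fixes a a' :: "'a::euclidean_space"
  assumes "(\<integral>\<^sup>+ y \<in> cube a l. ennreal \<bar>f y\<bar> \<partial>lebesgue)
      \<le> K * (\<integral>\<^sup>+ y \<in> cube a' l'. ennreal \<bar>g y\<bar> \<partial>lebesgue)"
    and "0 < l" "0 < l'" "l' \<le> r * l" "0 < r"
  shows "cube_avg f a l \<le> ennreal (r ^ DIM('a)) * K * cube_avg g a' l'"
proof -
  have "1 / l ^ DIM('a) \<le> r ^ DIM('a) * (1 / l' ^ DIM('a))"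
    using power_mono[OF assms(4), of "DIM('a)"] assms by (simp add: field_simps)
  then have "cube_avg f a l \<le> ennreal (r ^ DIM('a) * (1 / l' ^ DIM('a))) *
      (K * (\<integral>\<^sup>+ y \<in> cube a' l'. ennreal \<bar>g y\<bar> \<partial>lebesgue))"
    unfolding cube_avg_def using assms(1) by (intro mult_mono ennreal_leI) auto
  also have "\<dots> = ennreal (r ^ DIM('a)) * K * cube_avg g a' l'"
    using assms by (subst ennreal_mult) (auto simp: cube_avg_def ac_simps)
  finally show ?thesis .
qed

lemma cube_avg_enlarge:
  fixes a :: "'a::euclidean_space"
  assumes "cube a l \<subseteq> cube a' l'" "0 < l" "0 < l'" "l' \<le> r * l" "0 < r"
  shows "cube_avg f a l \<le> ennreal (r ^ DIM('a)) * cube_avg f a' l'"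
proof -
  have "(\<integral>\<^sup>+ y \<in> cube a l. ennreal \<bar>f y\<bar> \<partial>lebesgue) \<le> 1 * (\<integral>\<^sup>+ y \<in> cube a' l'. ennreal \<bar>f y\<bar> \<partial>lebesgue)"
    unfolding mult_1 using assms(1) by (intro nn_integral_mono) (auto split: split_indicator)
  from cube_avg_compare[OF this assms(2-)] show ?thesis by simp
qed

text \<open>Serves twice: to make a point interior for the lower semicontinuity, and to keep it
  inside the enlarged cubes of the grid argument.\<close>

lemma interior_cube_mem:
  assumes "x \<in> cube a l" "0 < d"
  shows "x \<in> box (a - d *\<^sub>R One) (a - d *\<^sub>R One + (l + 2 * d) *\<^sub>R One)"
proof -
  have "a \<bullet> i - d < x \<bullet> i \<and> x \<bullet> i < a \<bullet> i - d + (l + 2 * d)" if "i \<in> Basis" for i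
    using that assms by (force simp: mem_cube)
  then show ?thesis
    unfolding mem_box inner_add_left inner_diff_left inner_scaleR_left by auto
qed

text \<open>The maximal function is lower semicontinuous: a cube can be enlarged so that the
  point becomes interior, at an arbitrarily small loss in the average.\<close>
lemma open_less_maximal: "open {x. t < maximal f x}"
proof (subst open_subopen, intro ballI)
  fix x assume "x \<in> {x. t < maximal f x}"
  then obtain a l where al: "0 < l" "x \<in> cube a l" "t < cube_avg f a l"
    by (auto simp: less_maximal_iff)
  \<comment> \<open>\<open>C r\<close> is the average over the concentric cube dilated by
    \<open>r\<close>. The strict inequality \<open>t < cube_avg f a l\<close> leaves room for the
    loss r^n when \<open>r\<close> is close to 1.\<close>
  define C where "C r = cube_avg f (a - ((r - 1) / 2 * l) *\<^sub>R One) (r * l)" for r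
  have sub: "cube a l \<subseteq> cube (a - ((r - 1) / 2 * l) *\<^sub>R One) (r * l)" if "1 < r" for r
  proof
    fix y assume "y \<in> cube a l"
    have "l + 2 * ((r - 1) / 2 * l) = r * l"
      by (simp add: field_simps)
    with interior_cube_mem[OF \<open>y \<in> cube a l\<close>, of "(r - 1) / 2 * l"] that al(1)
    have "y \<in> box (a - ((r - 1) / 2 * l) *\<^sub>R One) (a - ((r - 1) / 2 * l) *\<^sub>R One + (r * l) *\<^sub>R One)"
      by simp
    then show "y \<in> cube (a - ((r - 1) / 2 * l) *\<^sub>R One) (r * l)"
      unfolding cube_def using box_subset_cbox by blast
  qed
  have ge: "cube_avg f a l \<le> ennreal (r ^ DIM('a)) * C r" if "1 < r" for r
    unfolding C_def using that al by (intro cube_avg_enlarge sub) auto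
  have "((\<lambda>r. ennreal (r ^ DIM('a)) * t) \<longlongrightarrow> ennreal (1 ^ DIM('a)) * t) (at_right 1)"
    by (intro tendsto_intros ennreal_tendsto_cmult) auto
  then have "\<forall>\<^sub>F r in at_right 1. ennreal (r ^ DIM('a)) * t < cube_avg f a l"
    using al(3) by (intro order_tendstoD(2)) auto
  then obtain r where r: "1 < r" "ennreal (r ^ DIM('a)) * t < cube_avg f a l"
    using eventually_happens[OF eventually_conj[OF _ eventually_at_right_less]] by fastforce
  with ge[OF r(1)] have "ennreal (r ^ DIM('a)) * t < ennreal (r ^ DIM('a)) * C r"
    by simp
  then have "t < C r"
    by (meson leD leI mult_left_mono zero_le)
  let ?B = "box (a - ((r - 1) / 2 * l) *\<^sub>R One) (a - ((r - 1) / 2 * l) *\<^sub>R One + (r * l) *\<^sub>R One)"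
  have "l + 2 * ((r - 1) / 2 * l) = r * l"
    by (simp add: field_simps)
  with interior_cube_mem[OF al(2), of "(r - 1) / 2 * l"] r(1) al(1) have "x \<in> ?B"
    by simp
  moreover have "?B \<subseteq> {x. t < maximal f x}"
  proof
    fix y assume "y \<in> ?B"
    then have "y \<in> cube (a - ((r - 1) / 2 * l) *\<^sub>R One) (r * l)"
      unfolding cube_def using box_subset_cbox by blast
    then have "C r \<le> maximal f y"
      unfolding C_def using al(1) r(1) by (intro cube_avg_le_maximal) auto
    with \<open>t < C r\<close> show "y \<in> {x. t < maximal f x}"
      by simp
  qed
  ultimately show "\<exists>T. open T \<and> x \<in> T \<and> T \<subseteq> {x. t < maximal f x}"
    by blast
qed

lemma borel_measurable_maximal [measurable]: "maximal f \<in> borel_measurable borel"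
  by (rule borel_measurableI_greater) (simp add: open_less_maximal)

lemma borel_measurable_maximal_lebesgue [measurable]: "maximal f \<in> borel_measurable lebesgue"
  using borel_measurable_maximal by (simp add: measurable_completion)

section \<open>Bounded functions with bounded support\<close>

lemma MLp_pow_mono:
  assumes "\<And>x. \<bar>f x\<bar> \<le> \<bar>g x\<bar>" "0 \<le> p"
  shows "MLp_pow p w f \<le> MLp_pow p w g"
  unfolding MLp_pow_def
  by (intro nn_integral_mono mult_right_mono epowr_mono maximal_mono assms) auto

lemma MLp_pow_mult:
  assumes [measurable]: "f \<in> borel_measurable lebesgue" "w \<in> borel_measurable lebesgue" and "0 < c"
  shows "MLp_pow p w (\<lambda>x. c * f x) = ennreal (c powr p) * MLp_pow p w f"
proof -
  have "MLp_pow p w (\<lambda>x. c * f x) = (\<integral>\<^sup>+ x. ennreal (c powr p) * (epowr (maximal f x) p * ennreal (w x)) \<partial>lebesgue)"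
    unfolding MLp_pow_def using assms(3) by (simp add: maximal_mult epowr_mult mult.assoc)
  also have "\<dots> = ennreal (c powr p) * MLp_pow p w f"
    unfolding MLp_pow_def by (rule nn_integral_cmult) measurable
  finally show ?thesis .
qed

text \<open>Sublinearity of the maximal function combined with convexity of the p-th power. In this
  form, with the same \<open>K\<close> in hypothesis and conclusion, midpoints can be taken
  repeatedly without losing a constant, which keeps the average over signs free of any dependence on
  the number of signs.\<close>

lemma MLp_pow_midpoint_le:
  assumes [measurable]: "f \<in> borel_measurable lebesgue" "g \<in> borel_measurable lebesgue"
    "w \<in> borel_measurable lebesgue" and "1 \<le> p"
    and le: "MLp_pow p w f \<le> K" "MLp_pow p w g \<le> K"
  shows "MLp_pow p w (\<lambda>x. (f x + g x) / 2) \<le> K"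
proof -
  have "MLp_pow p w (\<lambda>x. (f x + g x) / 2) \<le> (\<integral>\<^sup>+ x. ennreal (1/2) *
      (epowr (maximal f x) p * ennreal (w x) + epowr (maximal g x) p * ennreal (w x)) \<partial>lebesgue)"
    unfolding MLp_pow_def
  proof (rule nn_integral_mono)
    fix x
    have "epowr (maximal (\<lambda>x. (f x + g x) / 2) x) p \<le> epowr (ennreal (1/2) * (maximal f x + maximal g x)) p"
      using assms by (intro epowr_mono maximal_midpoint_le) auto
    also have "\<dots> \<le> ennreal (1/2) * (epowr (maximal f x) p + epowr (maximal g x) p)"
      by (rule epowr_midpoint_le) fact
    finally have "epowr (maximal (\<lambda>x. (f x + g x) / 2) x) p * ennreal (w x) \<le> \<dots> * ennreal (w x)"
      by (rule mult_right_mono) simp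
    then show "epowr (maximal (\<lambda>x. (f x + g x) / 2) x) p * ennreal (w x) \<le> ennreal (1/2) *
      (epowr (maximal f x) p * ennreal (w x) + epowr (maximal g x) p * ennreal (w x))"
      by (simp only: mult.assoc distrib_right)
  qed
  also have "\<dots> = ennreal (1/2) * (MLp_pow p w f + MLp_pow p w g)"
    unfolding MLp_pow_def by (subst nn_integral_cmult, measurable, subst nn_integral_add, measurable)
  also have "\<dots> \<le> ennreal (1/2) * (K + K)"
    by (intro mult_left_mono add_mono le) auto
  also have "\<dots> = (ennreal (1/2) * ennreal 2) * K"
    by (simp add: mult.assoc mult_2)
  also have "ennreal (1/2) * ennreal 2 = 1"
    by (subst ennreal_half) auto
  finally show ?thesis by simp
qed

text \<open>The class to which \<open>T\<close> is applied: its members are locally integrable, lie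
  in L^p and, for a weight in N_p, in ML^p(w). Continuity is not demanded, since densities on unions
  of cubes and on differences of cubes must belong to it.\<close>

definition test_fun :: "('a::euclidean_space \<Rightarrow> real) \<Rightarrow> bool" where
  "test_fun f \<longleftrightarrow> f \<in> borel_measurable lebesgue \<and> (\<exists>B. \<forall>x. \<bar>f x\<bar> \<le> B) \<and> bounded {x. f x \<noteq> 0}"

lemma test_fun_measurable [measurable_dest]: "test_fun f \<Longrightarrow> f \<in> borel_measurable lebesgue"
  by (simp add: test_fun_def)

lemma test_fun_le:
  assumes "f \<in> borel_measurable lebesgue" "test_fun g" "\<And>x. \<bar>f x\<bar> \<le> \<bar>g x\<bar>"
  shows "test_fun f"
proof -
  have "{x. f x \<noteq> 0} \<subseteq> {x. g x \<noteq> 0}"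
  proof clarify
    fix x assume "g x = 0" "f x \<noteq> 0"
    then show False using assms(3)[of x] by simp
  qed
  moreover obtain B where "\<And>x. \<bar>g x\<bar> \<le> B"
    using assms(2) by (auto simp: test_fun_def)
  then have "\<And>x. \<bar>f x\<bar> \<le> B"
    using assms(3) order_trans by blast
  ultimately show ?thesis
    using assms(1,2) unfolding test_fun_def by (meson bounded_subset)
qed

lemma test_fun_add:
  assumes "test_fun f" "test_fun g"
  shows "test_fun (\<lambda>x. f x + g x)"
proof -
  obtain B B' where B: "\<And>x. \<bar>f x\<bar> \<le> B" "\<And>x. \<bar>g x\<bar> \<le> B'"
    using assms by (auto simp: test_fun_def)
  then have "\<bar>f x + g x\<bar> \<le> B + B'" for x
    by (meson abs_triangle_ineq add_mono order_trans)
  moreover have "bounded {x. f x + g x \<noteq> 0}"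
    by (rule bounded_subset[of "{x. f x \<noteq> 0} \<union> {x. g x \<noteq> 0}"]) (use assms in \<open>auto simp: test_fun_def\<close>)
  moreover have "(\<lambda>x. f x + g x) \<in> borel_measurable lebesgue"
    using assms by measurable
  ultimately show ?thesis
    unfolding test_fun_def by blast
qed

lemma test_fun_cmult:
  assumes "test_fun f"
  shows "test_fun (\<lambda>x. c * f x)"
proof -
  obtain B where "\<And>x. \<bar>f x\<bar> \<le> B"
    using assms by (auto simp: test_fun_def)
  then have "\<bar>c * f x\<bar> \<le> \<bar>c\<bar> * B" for x
    by (simp add: abs_mult mult_left_mono)
  moreover have "bounded {x. c * f x \<noteq> 0}"
    by (rule bounded_subset[of "{x. f x \<noteq> 0}"]) (use assms in \<open>auto simp: test_fun_def\<close>)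
  moreover have "(\<lambda>x. c * f x) \<in> borel_measurable lebesgue"
    using assms by measurable
  ultimately show ?thesis
    unfolding test_fun_def by blast
qed

lemma test_fun_diff:
  assumes "test_fun f" "test_fun g"
  shows "test_fun (\<lambda>x. f x - g x)"
  using test_fun_add[OF assms(1) test_fun_cmult[OF assms(2), of "-1"]] by simp

lemma test_fun_indicator:
  assumes "S \<in> sets lebesgue" "bounded S"
  shows "test_fun (indicator S)"
proof -
  have "{x. indicator S x \<noteq> (0::real)} = S"
    by (auto simp: indicator_def)
  moreover have "\<forall>x. \<bar>indicator S x\<bar> \<le> (1::real)"
    by (simp add: indicator_def)
  ultimately show ?thesis
    using assms unfolding test_fun_def by (metis borel_measurable_indicator)
qed

lemma test_fun_sum:
  assumes "\<And>i. i \<in> I \<Longrightarrow> test_fun (g i)"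
  shows "test_fun (\<lambda>x. \<Sum>i\<in>I. g i x)"
proof (cases "finite I")
  case True
  then show ?thesis
    using assms
  proof (induction I)
    case empty
    then show ?case by (auto simp: test_fun_def)
  qed (simp add: test_fun_add)
qed (auto simp: test_fun_def)

lemma test_fun_continuous:
  assumes "continuous_on UNIV f" "bounded {x. f x \<noteq> 0}"
  shows "test_fun f"
proof -
  obtain R where R: "\<And>x. f x \<noteq> 0 \<Longrightarrow> norm x \<le> R"
    using assms(2) by (auto simp: bounded_iff)
  have "compact (f ` cball 0 R)"
    using assms(1) by (intro compact_continuous_image continuous_on_subset[OF assms(1)]) auto
  then obtain B where B: "\<And>x. x \<in> cball 0 R \<Longrightarrow> \<bar>f x\<bar> \<le> B"
    by (fastforce dest: compact_imp_bounded simp: bounded_iff)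
  have "\<bar>f x\<bar> \<le> max B 0" for x
    using B[of x] R[of x] by (cases "f x = 0") auto
  moreover have "f \<in> borel_measurable lebesgue"
    using borel_measurable_continuous_onI[OF assms(1)] by (simp add: measurable_completion)
  ultimately show ?thesis
    using assms(2) unfolding test_fun_def by blast
qed

lemma integrable_test_fun:
  assumes "test_fun f"
  shows "integrable lebesgue f"
proof -
  obtain B R where "\<And>x. \<bar>f x\<bar> \<le> B" "\<And>x. f x \<noteq> 0 \<Longrightarrow> norm x \<le> R"
    using assms by (auto simp: test_fun_def bounded_iff)
  with test_fun_measurable[OF assms] show ?thesis
    by (intro integrableI_bounded_set[where A="cball 0 R" and B=B])
      (auto simp: emeasure_lborel_cball_finite[unfolded infinity_ennreal_def])
qed

lemma loc_integrable_test_fun: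
  assumes "test_fun f"
  shows "loc_integrable f"
  unfolding loc_integrable_def set_integrable_def
proof (intro conjI allI impI)
  fix K :: "'a set" assume "compact K"
  then have [measurable]: "K \<in> sets lebesgue"
    by (simp add: compact_imp_closed borel_closed)
  show "integrable lebesgue (\<lambda>x. indicator K x *\<^sub>R f x)"
    by (rule integrable_test_fun, rule test_fun_le[OF _ assms])
       (use test_fun_measurable[OF assms] in \<open>auto simp: indicator_def\<close>)
qed (rule test_fun_measurable[OF assms])

lemma in_Lp_test_fun:
  assumes "test_fun f" "0 < p"
  shows "in_Lp p f"
proof -
  obtain B where B: "\<And>x. \<bar>f x\<bar> \<le> B"
    using assms by (auto simp: test_fun_def)
  note [measurable] = test_fun_measurable[OF assms(1)]
  have "{x. \<bar>f x\<bar> powr p \<noteq> 0} = {x. f x \<noteq> 0}"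
    by auto
  then have "test_fun (\<lambda>x. \<bar>f x\<bar> powr p)"
    using assms B unfolding test_fun_def
    by (auto intro!: exI[of _ "B powr p"] powr_mono2)
  then have "integrable lebesgue (\<lambda>x. \<bar>f x\<bar> powr p)"
    by (rule integrable_test_fun)
  then show ?thesis
    unfolding in_Lp_def Lp_pow_def by (auto simp: integrable_iff_bounded)
qed

section \<open>Decay of the maximal function at infinity\<close>

lemma norm_le_coordinates:
  fixes x y :: "'a::euclidean_space"
  assumes "\<And>i. i \<in> Basis \<Longrightarrow> \<bar>y \<bullet> i - x \<bullet> i\<bar> \<le> r"
  shows "norm (y - x) \<le> real DIM('a) * r"
proof -
  have "norm (y - x) \<le> (\<Sum>i\<in>Basis. \<bar>(y - x) \<bullet> i\<bar>)"
    by (rule norm_le_l1)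
  also have "\<dots> \<le> (\<Sum>i\<in>(Basis::'a set). r)"
    using assms by (intro sum_mono) (simp add: inner_diff_left)
  finally show ?thesis by simp
qed

lemma norm_diff_cube_le:
  fixes x y :: "'a::euclidean_space"
  assumes "x \<in> cube a l" "y \<in> cube a l"
  shows "norm (x - y) \<le> real DIM('a) * l"
  using assms by (intro norm_le_coordinates) (fastforce simp: mem_cube)

text \<open>A cube through \<open>x\<close> contributes only if it meets the support. If its side is
  at least 1, the side is comparable to at least 1 + |x|, and the average is at most the total mass
  over the volume. If its side is less than 1, \<open>x\<close> stays in a bounded region, where the
  bound on \<open>f\<close> suffices.\<close>

lemma maximal_test_fun_decay:
  fixes f :: "'a::euclidean_space \<Rightarrow> real"
  assumes "test_fun f"
  obtains K where "0 < K" "\<And>x. maximal f x \<le> ennreal (K * (1 + norm x) powr (- real DIM('a)))"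
proof -
  obtain B R where B: "\<And>x. \<bar>f x\<bar> \<le> B" and R: "\<And>x. f x \<noteq> 0 \<Longrightarrow> norm x \<le> R"
    using assms by (auto simp: test_fun_def bounded_iff)
  have "0 \<le> B"
    using B[of 0] by simp
  define J where "J = (\<integral>x. \<bar>f x\<bar> \<partial>lebesgue)"
  have "0 \<le> J"
    by (simp add: J_def)
  have J: "(\<integral>\<^sup>+ x. ennreal \<bar>f x\<bar> \<partial>lebesgue) = ennreal J"
    unfolding J_def by (rule nn_integral_eq_integral) (use integrable_test_fun[OF assms] in auto)
  \<comment> \<open>Chosen so that 1 + |R| + n l is at most \<open>D * l\<close> when l is at least
    1, and at most \<open>D\<close> otherwise.\<close>
  define D where "D = 1 + \<bar>R\<bar> + real DIM('a)"
  have "1 \<le> D"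
    by (simp add: D_def)
  define K where "K = (J + B + 1) * D ^ DIM('a)"
  have "0 < K"
    using \<open>0 \<le> B\<close> \<open>0 \<le> J\<close> \<open>1 \<le> D\<close> by (simp add: K_def)
  have K: "K * (1 + norm x) powr (- real DIM('a)) = (J + B + 1) * (D / (1 + norm x)) ^ DIM('a)" for x :: 'a
  proof -
    have "0 < 1 + norm x"
      by (simp add: add_pos_nonneg)
    then show ?thesis
      by (simp add: K_def powr_minus powr_realpow field_simps)
  qed
  have "maximal f x \<le> ennreal (K * (1 + norm x) powr (- real DIM('a)))" for x
  proof (rule maximal_leI)
    fix a l assume al: "0 < l" "x \<in> cube a l"
    have px: "0 < 1 + norm x"
      by (simp add: add_pos_nonneg)
    show "cube_avg f a l \<le> ennreal (K * (1 + norm x) powr (- real DIM('a)))"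
    proof (cases "\<exists>y\<in>cube a l. f y \<noteq> 0")
      case False
      then have "cube_avg f a l \<le> ennreal 0"
        by (intro cube_avg_le_const al) auto
      then show ?thesis by simp
    next
      case True
      then obtain y where y: "y \<in> cube a l" "norm y \<le> R"
        using R by auto
      then have x: "1 + norm x \<le> 1 + \<bar>R\<bar> + real DIM('a) * l"
        using norm_diff_cube_le[OF al(2) y(1)] norm_triangle_sub[of x y] by linarith
      show ?thesis
      proof (cases "1 \<le> l")
        case l: True
        have "1 + \<bar>R\<bar> \<le> (1 + \<bar>R\<bar>) * l"
          using mult_left_mono[OF l, of "1 + \<bar>R\<bar>"] by simp
        with x have "1 + norm x \<le> D * l"
          by (simp add: D_def algebra_simps)
        then have "1 / l \<le> D / (1 + norm x)"
          using px al by (simp add: field_simps)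
        then have "(1 / l) ^ DIM('a) \<le> (D / (1 + norm x)) ^ DIM('a)"
          using al by (intro power_mono) auto
        then have le: "(1 / l ^ DIM('a)) * J \<le> (D / (1 + norm x)) ^ DIM('a) * (J + B + 1)"
          using \<open>0 \<le> B\<close> \<open>0 \<le> J\<close> by (intro mult_mono) (use px \<open>1 \<le> D\<close> in \<open>auto simp: power_one_over\<close>)
        have "cube_avg f a l \<le> ennreal (1 / l ^ DIM('a)) * ennreal J"
          unfolding cube_avg_def J[symmetric]
          by (intro mult_left_mono nn_integral_mono) (auto simp: indicator_def)
        also have "\<dots> = ennreal ((1 / l ^ DIM('a)) * J)"
          using \<open>0 \<le> J\<close> al by (subst ennreal_mult) auto
        also have "\<dots> \<le> ennreal (K * (1 + norm x) powr (- real DIM('a)))"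
          using le unfolding K by (intro ennreal_leI) (simp add: mult.commute)
        finally show ?thesis .
      next
        case False
        have "real DIM('a) * l \<le> real DIM('a)"
          using False by simp
        with x have "1 + norm x \<le> D"
          unfolding D_def by linarith
        then have "1 \<le> (D / (1 + norm x)) ^ DIM('a)"
          using px by (intro one_le_power) (simp add: field_simps)
        then have "B * 1 \<le> (J + B + 1) * (D / (1 + norm x)) ^ DIM('a)"
          using \<open>0 \<le> B\<close> \<open>0 \<le> J\<close> by (intro mult_mono) auto
        moreover have "cube_avg f a l \<le> ennreal B"
          by (intro cube_avg_le_const al B)
        ultimately show ?thesis
          unfolding K by (simp add: ennreal_leI order_trans)
      qed
    qed
  qed
  with \<open>0 < K\<close> show ?thesis
    by (rule that)
qed

text \<open>The p-th power of the decay (1 + |x|)^(-n) is precisely the factor that N_p makes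
  integrable against \<open>w\<close>.\<close>

lemma MLp_pow_test_fun_finite:
  fixes f :: "'a::euclidean_space \<Rightarrow> real"
  assumes "test_fun f" "in_Np p w" "0 < p"
  shows "MLp_pow p w f < top"
proof -
  obtain K where K: "0 < K" "\<And>x. maximal f x \<le> ennreal (K * (1 + norm x) powr (- real DIM('a)))"
    using maximal_test_fun_decay[OF assms(1)] by blast
  have w: "0 \<le> w x" for x
    using assms(2) by (auto simp: in_Np_def is_weight_def)
  have [measurable]: "w \<in> borel_measurable lebesgue"
    using assms(2) by (auto simp: in_Np_def is_weight_def loc_integrable_def)
  have [measurable]: "norm \<in> borel_measurable lebesgue"
    by (rule measurable_completion) simp
  let ?v = "\<lambda>x. ennreal (w x * (1 + norm x) powr (- (real DIM('a) * p)))"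
  have "MLp_pow p w f \<le> (\<integral>\<^sup>+ x. ennreal (K powr p) * ?v x \<partial>lebesgue)"
    unfolding MLp_pow_def
  proof (rule nn_integral_mono)
    fix x :: 'a
    have "epowr (maximal f x) p \<le> epowr (ennreal (K * (1 + norm x) powr (- real DIM('a)))) p"
      by (intro epowr_mono K) (use assms in auto)
    also have "\<dots> = ennreal (K powr p * (1 + norm x) powr (- (real DIM('a) * p)))"
      using K(1) by (simp add: powr_mult powr_powr)
    finally have "epowr (maximal f x) p * ennreal (w x) \<le> \<dots> * ennreal (w x)"
      by (intro mult_right_mono) auto
    also have "\<dots> = ennreal (K powr p) * ?v x"
      using w by (simp add: ennreal_mult[symmetric] ac_simps)
    finally show "epowr (maximal f x) p * ennreal (w x) \<le> ennreal (K powr p) * ?v x" .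
  qed
  also have "\<dots> = ennreal (K powr p) * (\<integral>\<^sup>+ x. ?v x \<partial>lebesgue)"
    by (rule nn_integral_cmult) measurable
  also have "\<dots> < top"
    using assms(2) by (simp add: in_Np_def ennreal_mult_less_top)
  finally show ?thesis .
qed

section \<open>Random signs\<close>

text \<open>The bounds on \<open>T\<close> are recorded for test functions, the class in which all
  densities constructed below lie. \<open>C\<close> enters as \<open>C powr p\<close> because
  \<open>MLp_pow\<close> is the p-th power of the norm.\<close>

locale MLp_bounded_operator =
  fixes T :: "('a::euclidean_space \<Rightarrow> real) \<Rightarrow> ('a \<Rightarrow> real)" and w :: "'a \<Rightarrow> real" and p C :: real
  assumes p: "1 < p" and C: "0 < C"
    and linear: "linear_op T"
    and Np: "in_Np p w"
    and T_measurable: "test_fun f \<Longrightarrow> T f \<in> borel_measurable lebesgue"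
    and T_bound: "test_fun f \<Longrightarrow> MLp_pow p w (T f) \<le> ennreal (C powr p) * MLp_pow p w f"
begin

lemma w_nonneg: "0 \<le> w x"
  using Np by (auto simp: in_Np_def is_weight_def)

lemma w_loc_integrable: "loc_integrable w"
  using Np by (auto simp: in_Np_def is_weight_def)

lemma w_measurable [measurable]: "w \<in> borel_measurable lebesgue"
  using w_loc_integrable by (auto simp: loc_integrable_def)

text \<open>The average of \<open>|T (g0 \<plusminus> g 1 \<plusminus> g 2 \<plusminus> \<dots>)|\<close> over all signs dominates each \<open>|T (g i)|\<close>,
  while the maximal functions of all these signed sums are at most that of \<open>G\<close>.\<close>
lemma random_signs:
  assumes "finite I" "\<And>i. i \<in> I \<Longrightarrow> test_fun (g i)" "test_fun g0" "test_fun G"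
    and "\<And>x. \<bar>g0 x\<bar> + (\<Sum>i\<in>I. \<bar>g i x\<bar>) \<le> G x"
  shows "\<exists>H \<in> borel_measurable lebesgue. (\<forall>x. \<bar>T g0 x\<bar> \<le> H x) \<and>
    (\<forall>i\<in>I. \<forall>x. \<bar>T (g i) x\<bar> \<le> H x) \<and> MLp_pow p w H \<le> ennreal (C powr p) * MLp_pow p w G"
  using assms
\<comment> \<open>\<open>g0\<close> is the signed sum chosen so far. It has to vary, since the
  induction hypothesis is applied to both \<open>g0 + g i\<close> and \<open>g0 - g i\<close>; by
  the triangle inequality both fit under the same \<open>G\<close>.\<close>
proof (induction I arbitrary: g0)
  case empty
  have "MLp_pow p w (\<lambda>x. \<bar>T g0 x\<bar>) \<le> MLp_pow p w (T g0)"
    using p by (intro MLp_pow_mono) auto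
  also have "\<dots> \<le> ennreal (C powr p) * MLp_pow p w g0"
    using empty by (intro T_bound)
  also have "\<dots> \<le> ennreal (C powr p) * MLp_pow p w G"
    using empty(4) p by (intro mult_left_mono MLp_pow_mono) (auto intro: order_trans[OF _ abs_ge_self])
  finally show ?case
    using T_measurable[OF empty(2)] by (intro bexI[of _ "\<lambda>x. \<bar>T g0 x\<bar>"]) auto
next
  case (insert i I)
  have i: "test_fun (g i)"
    using insert by simp
  have bound: "\<bar>g0 x\<bar> + (\<bar>g i x\<bar> + (\<Sum>i\<in>I. \<bar>g i x\<bar>)) \<le> G x" for x
    using insert.prems(4)[of x] insert.hyps by simp
  note loc = loc_integrable_test_fun[OF insert.prems(2)] loc_integrable_test_fun[OF i]
    loc_integrable_test_fun[OF test_fun_cmult[OF i, of "-1"]]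
  have plus: "T (\<lambda>x. g0 x + g i x) = (\<lambda>x. T g0 x + T (g i) x)"
    using linear loc by (simp add: linear_op_def)
  have "T (\<lambda>x. g0 x + (-1) * g i x) = (\<lambda>x. T g0 x + (-1) * T (g i) x)"
    using linear loc unfolding linear_op_def by metis
  then have minus: "T (\<lambda>x. g0 x - g i x) = (\<lambda>x. T g0 x - T (g i) x)"
    by simp
  obtain H1 where H1: "H1 \<in> borel_measurable lebesgue" "\<And>x. \<bar>T g0 x + T (g i) x\<bar> \<le> H1 x"
    "\<And>j x. j \<in> I \<Longrightarrow> \<bar>T (g j) x\<bar> \<le> H1 x" "MLp_pow p w H1 \<le> ennreal (C powr p) * MLp_pow p w G"
  proof -
    have "\<exists>H \<in> borel_measurable lebesgue. (\<forall>x. \<bar>T (\<lambda>x. g0 x + g i x) x\<bar> \<le> H x) \<and>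
      (\<forall>i\<in>I. \<forall>x. \<bar>T (g i) x\<bar> \<le> H x) \<and> MLp_pow p w H \<le> ennreal (C powr p) * MLp_pow p w G"
    proof (intro insert.IH test_fun_add insert.prems)
      show "\<bar>g0 x + g i x\<bar> + (\<Sum>i\<in>I. \<bar>g i x\<bar>) \<le> G x" for x
        using bound[of x] abs_triangle_ineq[of "g0 x" "g i x"] by linarith
    qed auto
    then show ?thesis
      using that unfolding plus by blast
  qed
  obtain H2 where H2: "H2 \<in> borel_measurable lebesgue" "\<And>x. \<bar>T g0 x - T (g i) x\<bar> \<le> H2 x"
    "\<And>j x. j \<in> I \<Longrightarrow> \<bar>T (g j) x\<bar> \<le> H2 x" "MLp_pow p w H2 \<le> ennreal (C powr p) * MLp_pow p w G"
  proof -
    have "\<exists>H \<in> borel_measurable lebesgue. (\<forall>x. \<bar>T (\<lambda>x. g0 x - g i x) x\<bar> \<le> H x) \<and>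
      (\<forall>i\<in>I. \<forall>x. \<bar>T (g i) x\<bar> \<le> H x) \<and> MLp_pow p w H \<le> ennreal (C powr p) * MLp_pow p w G"
    proof (intro insert.IH test_fun_diff insert.prems)
      show "\<bar>g0 x - g i x\<bar> + (\<Sum>i\<in>I. \<bar>g i x\<bar>) \<le> G x" for x
        using bound[of x] abs_triangle_ineq4[of "g0 x" "g i x"] by linarith
    qed auto
    then show ?thesis
      using that unfolding minus by blast
  qed
  \<comment> \<open>The mean of |u + v| and |u - v| is at least both |u| and |v|, here with u =
    \<open>T g0 x\<close> and v = \<open>T (g i) x\<close>. The terms in \<open>I\<close> are
    dominated by \<open>H1\<close> and by \<open>H2\<close>, hence by their mean.\<close>
  show ?case
  proof (intro bexI[of _ "\<lambda>x. (H1 x + H2 x) / 2"] conjI allI ballI)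
    fix x
    show "\<bar>T g0 x\<bar> \<le> (H1 x + H2 x) / 2"
      using H1(2)[of x] H2(2)[of x] unfolding abs_le_iff by auto
    fix j assume "j \<in> insert i I"
    then consider "j = i" | "j \<in> I" by blast
    then show "\<bar>T (g j) x\<bar> \<le> (H1 x + H2 x) / 2"
    proof cases
      case 1
      then show ?thesis using H1(2)[of x] H2(2)[of x] unfolding abs_le_iff by auto
    next
      case 2
      then show ?thesis using H1(3)[OF 2, of x] H2(3)[OF 2, of x] unfolding abs_le_iff by auto
    qed
  next
    show "MLp_pow p w (\<lambda>x. (H1 x + H2 x) / 2) \<le> ennreal (C powr p) * MLp_pow p w G"
      using H1 H2 p by (intro MLp_pow_midpoint_le) auto
  qed (use H1(1) H2(1) in measurable)
qed

end

section \<open>The round trip at many scales\<close>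

lemma sum_single:
  fixes f :: "'i \<Rightarrow> 'b::comm_monoid_add"
  assumes "finite I" "i \<in> I" "\<And>j. j \<in> I \<Longrightarrow> j \<noteq> i \<Longrightarrow> f j = 0"
  shows "sum f I = f i"
  using assms sum.remove[OF assms(1,2), of f] by (simp add: sum.neutral)

text \<open>\<open>X l\<close> is a choice of the translation vector for side length
  \<open>l\<close>. It depends on the size of a cube and not on its position, so all cubes of one
  scale move in parallel and their corners stay separated.\<close>

locale MLp_bounded_nondegenerate = MLp_bounded_operator T w p C
  for T :: "('a::euclidean_space \<Rightarrow> real) \<Rightarrow> ('a \<Rightarrow> real)" and w p C +
  fixes c0 :: real and X :: "real \<Rightarrow> 'a"
  assumes c0: "0 < c0"
    and nondegenerate: "\<lbrakk>0 < l; loc_integrable f; \<And>y. 0 \<le> f y;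
      x \<in> cube (a + X l) l \<union> cube (a - X l) l\<rbrakk> \<Longrightarrow>
      (LINT y:cube a l|lebesgue. f y) / l ^ DIM('a)
        \<le> c0 * \<bar>T (\<lambda>y. indicator (cube a l) y * f y) x\<bar>"
begin

lemma average_le_T:
  assumes "0 < l" "test_fun f" "\<And>y. 0 \<le> f y" "\<And>y. y \<notin> cube a l \<Longrightarrow> f y = 0"
    and "x \<in> cube (a + X l) l \<union> cube (a - X l) l"
  shows "(\<integral>y. f y \<partial>lebesgue) / l ^ DIM('a) \<le> c0 * \<bar>T f x\<bar>"
proof -
  have "(\<lambda>y. indicator (cube a l) y * f y) = f"
    using assms(4) by (fastforce simp: indicator_def)
  with nondegenerate[OF assms(1) loc_integrable_test_fun[OF assms(2)] assms(3,5)] show ?thesis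
    by (simp add: set_lebesgue_integral_def)
qed

text \<open>The operator is applied twice: first to move the mass at each point \<open>a\<close>, spread over
  \<open>N\<close> scales \<open>l k\<close>, to the far away cubes \<open>cube (a + X (l k)) (l k)\<close>, and then to bring each
  of them back to \<open>cube a (l k)\<close>. Every scale returns a mass comparable to \<open>c a\<close>. As the ratio of
  consecutive scales is 4, discarding from a translated cube all the smaller ones keeps at least
  half of it.\<close>
lemma mass_amplification:
  fixes A :: "'a set" and c :: "'a \<Rightarrow> real" and N :: nat and \<epsilon> :: real
  assumes "0 < \<epsilon>" "finite A" and c: "\<And>a. a \<in> A \<Longrightarrow> 0 \<le> c a"
    and separated: "\<And>a b. \<lbrakk>a \<in> A; b \<in> A; a \<noteq> b\<rbrakk> \<Longrightarrow> \<exists>i\<in>Basis. \<epsilon> \<le> \<bar>a \<bullet> i - b \<bullet> i\<bar>"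
  shows "\<exists>H \<in> borel_measurable lebesgue. (\<forall>x. 0 \<le> H x) \<and>
    (\<forall>a\<in>A. ennreal (real N * c a) \<le> (\<integral>\<^sup>+ x \<in> cube a (\<epsilon> / 4). ennreal (H x) \<partial>lebesgue)) \<and>
    MLp_pow p w H \<le> ennreal ((4 * c0\<^sup>2 * C\<^sup>2) powr p) *
      MLp_pow p w (\<lambda>x. \<Sum>a\<in>A. c a / (\<epsilon> / 4 ^ N) ^ DIM('a) * indicator (cube a (\<epsilon> / 4 ^ N)) x)"
proof -
  \<comment> \<open>The scales run from \<open>l 0 = \<epsilon> / 4 ^ N\<close>, the cubes carrying
    the concentrated mass, up to \<open>l N = \<epsilon>\<close>. Transport uses k < N, so every
    cube that is moved has side at most \<epsilon>/4.\<close>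
  define l where "l k = \<epsilon> / 4 ^ N * 4 ^ k" for k :: nat
  have l_pos: "0 < l k" for k
    using assms(1) by (simp add: l_def)
  have l_Suc: "l (Suc k) = 4 * l k" for k
    by (simp add: l_def)
  have l_N: "l N = \<epsilon>"
    by (simp add: l_def)
  have l_mono: "l j \<le> l k" if "j \<le> k" for j k
    using assms(1) that by (simp add: l_def divide_right_mono power_increasing)
  have l_le: "l k \<le> \<epsilon> / 4" if "k < N" for k
    using l_mono[of "Suc k" N] that l_Suc[of k] l_N by simp
  have four: "4 \<le> (4::real) ^ DIM('a)"
    using power_increasing[of 1 "DIM('a)" "4::real"] by (simp add: Suc_leI)
  \<comment> \<open>Two points within \<open>s\<close> of each other in each coordinate cannot lie
    in parallel translates of cubes with different corners, as these corners would differ by at most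
    s + t < \<epsilon> in every coordinate. With s = 0 this is disjointness of cubes of one scale;
    with s = \<open>l k\<close> it says that a cube of side \<open>l k\<close> meets at most one
    cube of a smaller scale.\<close>
  have unique: "b = b'" if bb': "b \<in> A" "b' \<in> A" "y \<in> cube e s" "y' \<in> cube e s"
    "y \<in> cube (b + u) t" "y' \<in> cube (b' + u) t" "s + t < \<epsilon>" for b b' y y' e u :: 'a and s t
  proof (rule ccontr)
    assume "b \<noteq> b'"
    then obtain i where i: "i \<in> Basis" "\<epsilon> \<le> \<bar>b \<bullet> i - b' \<bullet> i\<bar>"
      using separated bb'(1,2) by blast
    have "e \<bullet> i \<le> y \<bullet> i \<and> y \<bullet> i \<le> e \<bullet> i + s" "e \<bullet> i \<le> y' \<bullet> i \<and> y' \<bullet> i \<le> e \<bullet> i + s"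
      "b \<bullet> i + u \<bullet> i \<le> y \<bullet> i \<and> y \<bullet> i \<le> b \<bullet> i + u \<bullet> i + t"
      "b' \<bullet> i + u \<bullet> i \<le> y' \<bullet> i \<and> y' \<bullet> i \<le> b' \<bullet> i + u \<bullet> i + t"
      using bb' i(1) by (auto simp: mem_cube inner_simps)
    with i(2) bb'(7) show False
      by linarith
  qed

  define g where "g a x = c a / l 0 ^ DIM('a) * indicator (cube a (l 0)) x" for a x :: 'a
  define f where "f x = (\<Sum>a\<in>A. g a x)" for x
  have g_nonneg: "0 \<le> g a x" if "a \<in> A" for a x
    using c[OF that] l_pos[of 0] by (simp add: g_def)
  have g_test: "test_fun (g a)" for a
    unfolding g_def by (intro test_fun_cmult test_fun_indicator) (auto simp: bounded_cube)
  have g_integral: "(\<integral>x. g a x \<partial>lebesgue) = c a" for a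
    using l_pos[of 0] by (simp add: g_def measure_cube less_imp_le)
  have f_test: "test_fun f"
    unfolding f_def[abs_def] by (intro test_fun_sum g_test)
  obtain H1 where H1: "H1 \<in> borel_measurable lebesgue" "\<And>x. 0 \<le> H1 x"
    "\<And>a x. a \<in> A \<Longrightarrow> \<bar>T (g a) x\<bar> \<le> H1 x" "MLp_pow p w H1 \<le> ennreal (C powr p) * MLp_pow p w f"
  proof -
    \<comment> \<open>The zero function is the initial term \<open>g0\<close>, so all cubes receive
      signs; its own bound makes the majorant non-negative.\<close>
    have "\<exists>H \<in> borel_measurable lebesgue. (\<forall>x. \<bar>T (\<lambda>x. 0) x\<bar> \<le> H x) \<and>
      (\<forall>a\<in>A. \<forall>x. \<bar>T (g a) x\<bar> \<le> H x) \<and> MLp_pow p w H \<le> ennreal (C powr p) * MLp_pow p w f"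
      by (rule random_signs[OF assms(2) g_test _ f_test]) (auto simp: test_fun_def f_def g_nonneg)
    then obtain H where H: "H \<in> borel_measurable lebesgue" "\<And>x. \<bar>T (\<lambda>x. 0) x\<bar> \<le> H x"
      "\<And>a x. a \<in> A \<Longrightarrow> \<bar>T (g a) x\<bar> \<le> H x" "MLp_pow p w H \<le> ennreal (C powr p) * MLp_pow p w f"
      by blast
    show ?thesis
      by (rule that[OF H(1) order_trans[OF abs_ge_zero H(2)] H(3,4)])
  qed
  \<comment> \<open>The support of \<open>g a\<close> lies in \<open>cube a (l k)\<close> for every
    \<open>k\<close>, so non-degeneracy can be tested at all scales on the same function, and the
    one majorant \<open>H1\<close> serves them all.\<close>
  have H1_ge: "c a / l k ^ DIM('a) \<le> c0 * H1 x" if "a \<in> A" "x \<in> cube (a + X (l k)) (l k)" for a k x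
  proof -
    have "y \<notin> cube a (l k) \<Longrightarrow> g a y = 0" for y
      using cube_mono[OF l_mono[of 0 k], of a] by (auto simp: g_def indicator_def)
    then have "(\<integral>y. g a y \<partial>lebesgue) / l k ^ DIM('a) \<le> c0 * \<bar>T (g a) x\<bar>"
      using that by (intro average_le_T l_pos g_test g_nonneg) auto
    also have "\<dots> \<le> c0 * H1 x"
      using H1(3) that c0 by simp
    finally show ?thesis
      by (simp add: g_integral)
  qed

  define S where "S k = (\<Union>b\<in>A. cube (b + X (l k)) (l k))" for k
  define F where "F a k = cube (a + X (l k)) (l k) - (\<Union>j<k. S j)" for a k
  have S_meas [measurable]: "S k \<in> sets lebesgue" for k
    unfolding S_def using assms(2) by (intro sets.finite_UN) auto
  have F_meas [measurable]: "F a k \<in> sets lebesgue" for a k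
    unfolding F_def by measurable
  have F_subset: "F a k \<subseteq> cube (a + X (l k)) (l k)" for a k
    by (auto simp: F_def)
  have F_unique: "a = b \<and> k = j"
    if "y \<in> F a k" "y \<in> F b j" "a \<in> A" "b \<in> A" "k < N" "j < N" for y a b k j
  proof -
    have "\<not> j < k" "\<not> k < j"
      using that unfolding F_def S_def by blast+
    then have "j = k" by simp
    moreover have "y \<in> cube y 0"
      by (simp add: mem_cube)
    then have "a = b"
      using that F_subset[of a k] F_subset[of b j] \<open>j = k\<close> l_le[of k] assms(1)
      by (intro unique[of a b y y 0 y "X (l k)" "l k"]) auto
    ultimately show ?thesis by simp
  qed
  \<comment> \<open>Since 4^n is at least 4, the volumes grow at least geometrically with ratio 4.
    In the induction step, one half plus one copy of the volume at scale \<open>k\<close> is at most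
    twice that volume, hence at most half of the next.\<close>
  have sum_l: "(\<Sum>j<k. l j ^ DIM('a)) \<le> l k ^ DIM('a) / 2" for k
  proof (induction k)
    case 0
    then show ?case using l_pos[of 0] by simp
  next
    case (Suc k)
    have "4 * l k ^ DIM('a) \<le> l (Suc k) ^ DIM('a)"
      unfolding l_Suc power_mult_distrib using four l_pos[of k] by (intro mult_right_mono) auto
    moreover have "0 \<le> l k ^ DIM('a)"
      using l_pos[of k] by simp
    ultimately show ?case
      using Suc by simp
  qed
  have F_measure: "l k ^ DIM('a) / 2 \<le> measure lebesgue (F a k)" if "a \<in> A" "k < N" for a k
  proof -
    let ?Q = "cube (a + X (l k)) (l k)"
    have Q_fm: "?Q \<in> fmeasurable lebesgue"
      by (simp add: cube_def)
    have QS_fm: "?Q \<inter> S j \<in> fmeasurable lebesgue" for j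
      using fmeasurable_Int_fmeasurable[OF Q_fm S_meas] .
    \<comment> \<open>Although \<open>S j\<close> is a union over all of \<open>A\<close>, only one
      of its cubes can meet \<open>?Q\<close>, by \<open>unique\<close> with l k + l j < \<epsilon>.
      Each smaller scale therefore removes at most the volume of one cube.\<close>
    have "measure lebesgue (?Q \<inter> S j) \<le> l j ^ DIM('a)" if "j < k" for j
    proof (cases "?Q \<inter> S j = {}")
      case True
      then show ?thesis using l_pos[of j] by simp
    next
      case False
      then obtain b y where b: "b \<in> A" "y \<in> ?Q" "y \<in> cube (b + X (l j)) (l j)"
        by (auto simp: S_def)
      have "?Q \<inter> S j \<subseteq> cube (b + X (l j)) (l j)"
      proof clarify
        fix z assume z: "z \<in> ?Q" "z \<in> S j"
        then obtain b' where b': "b' \<in> A" "z \<in> cube (b' + X (l j)) (l j)"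
          by (auto simp: S_def)
        have "l k + l j < \<epsilon>"
          using l_le[of k] l_le[of j] \<open>j < k\<close> \<open>k < N\<close> assms(1) by simp
        with unique[OF b'(1) b(1) z(1) b(2) b'(2) b(3)] b' show "z \<in> cube (b + X (l j)) (l j)"
          by simp
      qed
      then have "measure lebesgue (?Q \<inter> S j) \<le> measure lebesgue (cube (b + X (l j)) (l j))"
        using QS_fm by (intro measure_mono_fmeasurable) (auto simp: cube_def)
      also have "\<dots> = l j ^ DIM('a)"
        using l_pos[of j] by (simp add: measure_cube)
      finally show ?thesis .
    qed
    then have "measure lebesgue (\<Union>j<k. ?Q \<inter> S j) \<le> (\<Sum>j<k. l j ^ DIM('a))"
      using QS_fm by (intro order_trans[OF measure_UNION_le] sum_mono) auto
    with sum_l[of k] have "measure lebesgue (\<Union>j<k. ?Q \<inter> S j) \<le> l k ^ DIM('a) / 2"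
      by linarith
    moreover have "measure lebesgue (?Q - (\<Union>j<k. ?Q \<inter> S j)) = measure lebesgue ?Q - measure lebesgue (\<Union>j<k. ?Q \<inter> S j)"
      using Q_fm by (intro measurable_measure_Diff sets.finite_UN) auto
    moreover have "?Q - (\<Union>j<k. ?Q \<inter> S j) = F a k"
      by (auto simp: F_def)
    ultimately show ?thesis
      using l_pos[of k] by (simp add: measure_cube)
  qed

  define h where "h = (\<lambda>(a, k) x. c a / l k ^ DIM('a) * indicator (F a k) x)"
  define G where "G x = (\<Sum>i\<in>A \<times> {..<N}. h i x)" for x
  have h_test: "test_fun (h i)" for i
    unfolding h_def case_prod_beta
    by (intro test_fun_cmult test_fun_indicator bounded_subset[OF bounded_cube F_subset]) auto
  have h_nonneg: "0 \<le> h i x" if "i \<in> A \<times> {..<N}" for i x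
    using that c l_pos by (auto simp: h_def less_imp_le)
  have G_test: "test_fun G"
    unfolding G_def[abs_def] by (intro test_fun_sum h_test)
  have fin: "finite (A \<times> {..<N})"
    using assms(2) by simp
  \<comment> \<open>The sets \<open>F a k\<close> are pairwise disjoint, so at each point at most
    one summand of \<open>G\<close> is non-zero. This is where stacking \<open>N\<close> scales
    costs no factor \<open>N\<close>.\<close>
  have G_le: "G x \<le> c0 * H1 x" for x
  proof (cases "\<exists>a\<in>A. \<exists>k<N. x \<in> F a k")
    case False
    then have "G x = 0"
      unfolding G_def by (intro sum.neutral) (auto simp: h_def)
    then show ?thesis using H1(2)[of x] c0 by simp
  next
    case True
    then obtain a k where ak: "a \<in> A" "k < N" "x \<in> F a k" by blast
    have "h i x = 0" if i: "i \<in> A \<times> {..<N}" "i \<noteq> (a, k)" for i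
    proof -
      obtain b j where b: "i = (b, j)" by (cases i)
      have "x \<notin> F b j"
        using F_unique[OF _ ak(3), of b j] i ak(1,2) unfolding b by blast
      then show ?thesis by (simp add: b h_def)
    qed
    then have "G x = h (a, k) x"
      unfolding G_def using ak by (intro sum_single fin) auto
    also have "\<dots> = c a / l k ^ DIM('a)"
      using ak by (simp add: h_def)
    also have "\<dots> \<le> c0 * H1 x"
      using ak F_subset by (intro H1_ge) auto
    finally show ?thesis .
  qed
  have G_nonneg: "0 \<le> G x" for x
    unfolding G_def by (intro sum_nonneg h_nonneg)
  have "MLp_pow p w G \<le> MLp_pow p w (\<lambda>x. c0 * H1 x)"
    using G_le G_nonneg p by (intro MLp_pow_mono) (auto intro: order_trans[OF _ abs_ge_self])
  also have "\<dots> = ennreal (c0 powr p) * MLp_pow p w H1"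
    using H1(1) c0 by (intro MLp_pow_mult) auto
  also have "\<dots> \<le> ennreal (c0 powr p) * (ennreal (C powr p) * MLp_pow p w f)"
    by (intro mult_left_mono H1) auto
  finally have MLp_G: "MLp_pow p w G \<le> \<dots>" .
  obtain H2 where H2: "H2 \<in> borel_measurable lebesgue" "\<And>x. 0 \<le> H2 x"
    "\<And>i x. i \<in> A \<times> {..<N} \<Longrightarrow> \<bar>T (h i) x\<bar> \<le> H2 x" "MLp_pow p w H2 \<le> ennreal (C powr p) * MLp_pow p w G"
  proof -
    have "\<exists>H \<in> borel_measurable lebesgue. (\<forall>x. \<bar>T (\<lambda>x. 0) x\<bar> \<le> H x) \<and>
      (\<forall>i\<in>A \<times> {..<N}. \<forall>x. \<bar>T (h i) x\<bar> \<le> H x) \<and> MLp_pow p w H \<le> ennreal (C powr p) * MLp_pow p w G"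
      by (rule random_signs[OF fin h_test _ G_test]) (auto simp: test_fun_def G_def h_nonneg)
    then obtain H where H: "H \<in> borel_measurable lebesgue" "\<And>x. \<bar>T (\<lambda>x. 0) x\<bar> \<le> H x"
      "\<And>i x. i \<in> A \<times> {..<N} \<Longrightarrow> \<bar>T (h i) x\<bar> \<le> H x" "MLp_pow p w H \<le> ennreal (C powr p) * MLp_pow p w G"
      by blast
    show ?thesis
      by (rule that[OF H(1) order_trans[OF abs_ge_zero H(2)] H(3,4)])
  qed
  \<comment> \<open>The return trip uses the opposite translation: \<open>cube a (l k)\<close> is
    the cube around \<open>F a k\<close> shifted by \<open>- X (l k)\<close>. The constant 4
    contains a 2 for the half of the cube that \<open>F a k\<close> may lack and a 2 for the half of
    \<open>cube a (l k)\<close> given up below in passing to an annulus.\<close>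
  have H2_ge: "2 * c a / l k ^ DIM('a) \<le> 4 * c0 * H2 x" if "a \<in> A" "k < N" "x \<in> cube a (l k)" for a k x
  proof -
    have "c a / l k ^ DIM('a) * (1 / 2) \<le> c a / l k ^ DIM('a) * (measure lebesgue (F a k) / l k ^ DIM('a))"
      using F_measure[OF that(1,2)] c[OF that(1)] l_pos[of k]
      by (intro mult_left_mono) (auto simp: field_simps)
    also have "\<dots> = (\<integral>y. h (a, k) y \<partial>lebesgue) / l k ^ DIM('a)"
      by (simp add: h_def)
    also have "\<dots> \<le> c0 * \<bar>T (h (a, k)) x\<bar>"
    proof (rule average_le_T[OF l_pos h_test])
      show "h (a, k) y = 0" if "y \<notin> cube (a + X (l k)) (l k)" for y
        using that F_subset[of a k] by (auto simp: h_def indicator_def)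
    qed (use that h_nonneg in auto)
    also have "\<dots> \<le> c0 * H2 x"
      using H2(3)[of "(a, k)" x] that c0 by simp
    finally show ?thesis by simp
  qed
  define H where "H x = 4 * c0 * H2 x" for x
  have H_meas [measurable]: "H \<in> borel_measurable lebesgue"
    using H2(1) by (simp add: H_def[abs_def])
  \<comment> \<open>\<open>H\<close> majorizes the returns of the single scales but not their sum,
    so the contributions are collected on the disjoint annuli \<open>?E\<close>. The inner side is
    written \<open>l m / 4\<close> so that m = 0 makes sense; for larger m it is the preceding
    scale, and for m = N it is \<epsilon>/4.\<close>
  have mass: "ennreal (real m * c a) \<le> (\<integral>\<^sup>+ x \<in> cube a (l m / 4). ennreal (H x) \<partial>lebesgue)"
    if "a \<in> A" "m \<le> N" for a m
    using that(2)
  proof (induction m)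
    case (Suc m)
    let ?E = "cube a (l m) - cube a (l m / 4)"
    have sub: "cube a (l m / 4) \<subseteq> cube a (l m)"
      using l_pos[of m] by (intro cube_mono) auto
    have "measure lebesgue ?E = l m ^ DIM('a) - (l m / 4) ^ DIM('a)"
      using sub l_pos[of m] by (subst measurable_measure_Diff) (auto simp: measure_cube, simp add: cube_def)
    moreover have "(l m / 4) ^ DIM('a) \<le> l m ^ DIM('a) / 2"
      using four l_pos[of m] by (simp add: power_divide field_simps)
    ultimately have E: "l m ^ DIM('a) / 2 \<le> measure lebesgue ?E"
      by linarith
    have "?E \<in> fmeasurable lebesgue"
      by (intro fmeasurable.Diff) (auto simp: cube_def)
    then have eE: "emeasure lebesgue ?E = ennreal (measure lebesgue ?E)"
      by (intro emeasure_eq_measure2) (auto simp: fmeasurable_def)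
    have "c a = 2 * c a / l m ^ DIM('a) * (l m ^ DIM('a) / 2)"
      using l_pos[of m] by simp
    also have "\<dots> \<le> 2 * c a / l m ^ DIM('a) * measure lebesgue ?E"
      using E l_pos[of m] c[OF that(1)] by (intro mult_left_mono) auto
    finally have "ennreal (c a) \<le> ennreal (2 * c a / l m ^ DIM('a)) * emeasure lebesgue ?E"
      unfolding eE using l_pos[of m] c[OF that(1)] by (subst ennreal_mult[symmetric]) (auto intro: ennreal_leI)
    also have "\<dots> = (\<integral>\<^sup>+ x \<in> ?E. ennreal (2 * c a / l m ^ DIM('a)) \<partial>lebesgue)"
      by (rule nn_integral_cmult_indicator[symmetric]) auto
    also have "\<dots> \<le> (\<integral>\<^sup>+ x \<in> ?E. ennreal (H x) \<partial>lebesgue)"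
      unfolding H_def using H2_ge[OF that(1), of m] Suc.prems
      by (intro nn_integral_mono) (auto simp: indicator_def intro: ennreal_leI)
    finally have "ennreal (real m * c a) + ennreal (c a)
      \<le> (\<integral>\<^sup>+ x \<in> cube a (l m / 4). ennreal (H x) \<partial>lebesgue) + (\<integral>\<^sup>+ x \<in> ?E. ennreal (H x) \<partial>lebesgue)"
      using Suc by (intro add_mono) auto
    also have "\<dots> = (\<integral>\<^sup>+ x. ennreal (H x) * indicator (cube a (l m / 4)) x + ennreal (H x) * indicator ?E x \<partial>lebesgue)"
      by (rule nn_integral_add[symmetric]) measurable
    also have "\<dots> = (\<integral>\<^sup>+ x \<in> cube a (l m). ennreal (H x) \<partial>lebesgue)"
      using sub by (intro nn_integral_cong) (auto simp: indicator_def)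
    finally show ?case
      using c[OF that(1)] by (simp add: l_Suc ennreal_plus[symmetric] distrib_right add.commute del: ennreal_plus)
  qed simp
  have "MLp_pow p w H = ennreal ((4 * c0) powr p) * MLp_pow p w H2"
    unfolding H_def[abs_def] using H2(1) c0 by (intro MLp_pow_mult) auto
  also have "\<dots> \<le> ennreal ((4 * c0) powr p) * (ennreal (C powr p) *
      (ennreal (c0 powr p) * (ennreal (C powr p) * MLp_pow p w f)))"
    by (intro mult_left_mono order_trans[OF H2(4)] MLp_G) auto
  also have "\<dots> = ennreal ((4 * c0) powr p * (C powr p * (c0 powr p * C powr p))) * MLp_pow p w f"
    by (simp add: ennreal_mult mult.assoc)
  also have "(4 * c0) powr p * (C powr p * (c0 powr p * C powr p)) = (4 * c0\<^sup>2 * C\<^sup>2) powr p"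
    by (simp add: powr_mult[symmetric] power2_eq_square ac_simps)
  finally have "MLp_pow p w H \<le> ennreal ((4 * c0\<^sup>2 * C\<^sup>2) powr p) * MLp_pow p w f" .
  moreover have "f = (\<lambda>x. \<Sum>a\<in>A. c a / (\<epsilon> / 4 ^ N) ^ DIM('a) * indicator (cube a (\<epsilon> / 4 ^ N)) x)"
    by (simp add: f_def[abs_def] g_def l_def)
  ultimately show ?thesis
    using mass[of _ N] H2(2) c0 by (intro bexI[OF _ H_meas]) (auto simp: l_N H_def)
qed

end

section \<open>Strong type inequality for the maximal function\<close>

lemma sum_nn_integral_disjoint_le:
  assumes "finite B" "\<And>a. a \<in> B \<Longrightarrow> E a \<in> sets M" "h \<in> borel_measurable M"
    and disjoint: "\<And>a b x. \<lbrakk>a \<in> B; b \<in> B; x \<in> E a; x \<in> E b\<rbrakk> \<Longrightarrow> a = b"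
    and subset: "\<And>a. a \<in> B \<Longrightarrow> E a \<subseteq> S"
  shows "(\<Sum>a\<in>B. \<integral>\<^sup>+ x \<in> E a. h x \<partial>M) \<le> (\<integral>\<^sup>+ x \<in> S. h x \<partial>M)"
proof -
  have "(\<Sum>a\<in>B. \<integral>\<^sup>+ x \<in> E a. h x \<partial>M) = (\<integral>\<^sup>+ x. (\<Sum>a\<in>B. h x * indicator (E a) x) \<partial>M)"
    using assms(2,3) by (intro nn_integral_sum[symmetric]) auto
  also have "\<dots> \<le> (\<integral>\<^sup>+ x \<in> S. h x \<partial>M)"
  proof (rule nn_integral_mono)
    fix x
    show "(\<Sum>a\<in>B. h x * indicator (E a) x) \<le> h x * indicator S x"
    proof (cases "\<exists>a\<in>B. x \<in> E a")
      case True
      then obtain a where a: "a \<in> B" "x \<in> E a" by blast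
      have "h x * indicator (E b) x = 0" if "b \<in> B" "b \<noteq> a" for b
      proof -
        have "x \<notin> E b"
          using disjoint[OF that(1) a(1) _ a(2)] that(2) by blast
        then show ?thesis by simp
      qed
      then have "(\<Sum>a\<in>B. h x * indicator (E a) x) = h x * indicator (E a) x"
        by (intro sum_single assms(1) a)
      also have "\<dots> \<le> h x * indicator S x"
        using subset a by (auto simp: indicator_def)
      finally show ?thesis .
    next
      case False
      then have "(\<Sum>a\<in>B. h x * indicator (E a) x) = 0"
        by (intro sum.neutral) (auto simp: indicator_def)
      then show ?thesis by simp
    qed
  qed
  finally show ?thesis .
qed

text \<open>The lower corner of the half-open cell of mesh \<epsilon> containing \<open>x\<close>;
  the fibres of this map are the cells and partition the space.\<close>

definition grid_point :: "real \<Rightarrow> 'a::euclidean_space \<Rightarrow> 'a" where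
  "grid_point \<epsilon> x = (\<Sum>i\<in>Basis. (\<epsilon> * real_of_int \<lfloor>x \<bullet> i / \<epsilon>\<rfloor>) *\<^sub>R i)"

lemma grid_point_inner: "i \<in> Basis \<Longrightarrow> grid_point \<epsilon> x \<bullet> i = \<epsilon> * real_of_int \<lfloor>x \<bullet> i / \<epsilon>\<rfloor>"
  by (simp add: grid_point_def)

lemma mem_cube_grid_point:
  assumes "0 < \<epsilon>"
  shows "x \<in> cube (grid_point \<epsilon> x) \<epsilon>"
proof -
  have "\<epsilon> * real_of_int \<lfloor>x \<bullet> i / \<epsilon>\<rfloor> \<le> x \<bullet> i \<and> x \<bullet> i \<le> \<epsilon> * real_of_int \<lfloor>x \<bullet> i / \<epsilon>\<rfloor> + \<epsilon>" for i
  proof -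
    obtain k where k: "\<lfloor>x \<bullet> i / \<epsilon>\<rfloor> = k" by blast
    then have "real_of_int k \<le> x \<bullet> i / \<epsilon>" "x \<bullet> i / \<epsilon> < real_of_int k + 1"
      by linarith+
    then show ?thesis
      unfolding k using assms by (simp add: field_simps)
  qed
  then show ?thesis
    by (simp add: mem_cube grid_point_inner)
qed

text \<open>Some coordinate has different integer parts, and different integers differ by at least
  1. This is the separation that \<open>mass_amplification\<close> asks for.\<close>

lemma grid_point_separated:
  fixes x y :: "'a::euclidean_space"
  assumes "grid_point \<epsilon> x \<noteq> grid_point \<epsilon> y" "0 < \<epsilon>"
  shows "\<exists>i\<in>Basis. \<epsilon> \<le> \<bar>grid_point \<epsilon> x \<bullet> i - grid_point \<epsilon> y \<bullet> i\<bar>"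
proof -
  obtain i :: 'a where i: "i \<in> Basis" "\<lfloor>x \<bullet> i / \<epsilon>\<rfloor> \<noteq> \<lfloor>y \<bullet> i / \<epsilon>\<rfloor>"
  proof -
    have "\<exists>i\<in>Basis. \<lfloor>x \<bullet> i / \<epsilon>\<rfloor> \<noteq> \<lfloor>y \<bullet> i / \<epsilon>\<rfloor>"
    proof (rule ccontr)
      assume "\<not> ?thesis"
      then have "grid_point \<epsilon> x = grid_point \<epsilon> y"
        unfolding grid_point_def by (intro sum.cong) auto
      with assms(1) show False ..
    qed
    then show ?thesis using that by blast
  qed
  then have "1 \<le> \<bar>real_of_int \<lfloor>x \<bullet> i / \<epsilon>\<rfloor> - real_of_int \<lfloor>y \<bullet> i / \<epsilon>\<rfloor>\<bar>"
    by linarith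
  then have "\<epsilon> * 1 \<le> \<epsilon> * \<bar>real_of_int \<lfloor>x \<bullet> i / \<epsilon>\<rfloor> - real_of_int \<lfloor>y \<bullet> i / \<epsilon>\<rfloor>\<bar>"
    using assms(2) by (intro mult_left_mono) auto
  also have "\<dots> = \<bar>grid_point \<epsilon> x \<bullet> i - grid_point \<epsilon> y \<bullet> i\<bar>"
    unfolding grid_point_inner[OF i(1)] right_diff_distrib[symmetric] abs_mult using assms(2) by simp
  finally show ?thesis
    using i(1) by auto
qed

text \<open>The corners come from integer vectors with bounded entries. Finiteness lets the mass be
  handled by finite sums and by induction over signs.\<close>

lemma finite_grid_points:
  fixes S :: "'a::euclidean_space set"
  assumes "bounded S"
  shows "finite (grid_point \<epsilon> ` S)"
proof -
  obtain R where R: "\<And>x. x \<in> S \<Longrightarrow> norm x \<le> R"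
    using assms by (auto simp: bounded_iff)
  define m where "m = \<lceil>R / \<bar>\<epsilon>\<bar>\<rceil> + 1"
  have "grid_point \<epsilon> ` S \<subseteq> (\<lambda>z. \<Sum>i\<in>Basis. (\<epsilon> * real_of_int (z i)) *\<^sub>R i) ` (PiE (Basis :: 'a set) (\<lambda>_. {-m..m}))"
  proof (rule image_subsetI)
    fix x assume "x \<in> S"
    have "\<lfloor>x \<bullet> i / \<epsilon>\<rfloor> \<in> {-m..m}" if "i \<in> Basis" for i
    proof -
      have "\<bar>x \<bullet> i\<bar> \<le> R"
        using R[OF \<open>x \<in> S\<close>] Basis_le_norm[OF that, of x] by linarith
      then have "\<bar>x \<bullet> i / \<epsilon>\<bar> \<le> R / \<bar>\<epsilon>\<bar>"
        by (simp add: abs_divide divide_right_mono)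
      then have "x \<bullet> i / \<epsilon> \<le> R / \<bar>\<epsilon>\<bar>" "- (x \<bullet> i / \<epsilon>) \<le> R / \<bar>\<epsilon>\<bar>"
        by (simp_all only: abs_le_iff)
      then show ?thesis
        unfolding m_def atLeastAtMost_iff by linarith
    qed
    then show "grid_point \<epsilon> x \<in> (\<lambda>z. \<Sum>i\<in>Basis. (\<epsilon> * real_of_int (z i)) *\<^sub>R i) ` (PiE (Basis :: 'a set) (\<lambda>_. {-m..m}))"
      by (intro image_eqI[where x="\<lambda>i\<in>Basis. \<lfloor>x \<bullet> i / \<epsilon>\<rfloor>"]) (auto simp: grid_point_def intro!: sum.cong)
  qed
  then show ?thesis
    by (rule finite_subset) (intro finite_imageI finite_PiE; simp)
qed

lemma borel_measurable_grid_point: "grid_point \<epsilon> \<in> borel_measurable lebesgue"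
proof -
  have "grid_point \<epsilon> \<in> borel_measurable (borel :: 'a::euclidean_space measure)"
    unfolding grid_point_def[abs_def] by measurable
  then show ?thesis
    by (simp add: measurable_completion)
qed

text \<open>Turns pointwise comparisons of maximal functions into norm comparisons, at the price 2^p
  for splitting the sum. \<open>F\<close> enters by its own norm and not through a maximal
  function.\<close>

lemma MLp_pow_le_of_maximal_le:
  assumes [measurable]: "w \<in> borel_measurable lebesgue" "F \<in> borel_measurable lebesgue"
    and "1 \<le> p" "0 < r" "\<And>x. 0 \<le> F x" "\<And>x. 0 \<le> w x"
    and le: "\<And>x. maximal f x \<le> ennreal r * maximal g x + ennreal (F x)"
  shows "MLp_pow p w f \<le> ennreal (2 powr p * r powr p) * MLp_pow p w g
    + ennreal (2 powr p) * (\<integral>\<^sup>+ x. ennreal (F x powr p * w x) \<partial>lebesgue)"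
proof -
  have "MLp_pow p w f \<le> (\<integral>\<^sup>+ x. ennreal (2 powr p * r powr p) * (epowr (maximal g x) p * ennreal (w x))
    + ennreal (2 powr p) * ennreal (F x powr p * w x) \<partial>lebesgue)"
    unfolding MLp_pow_def
  proof (rule nn_integral_mono)
    fix x
    have "epowr (maximal f x) p \<le> epowr (ennreal r * maximal g x + ennreal (F x)) p"
      using assms by (intro epowr_mono) auto
    also have "\<dots> \<le> ennreal (2 powr p) * (epowr (ennreal r * maximal g x) p + epowr (ennreal (F x)) p)"
      by (rule epowr_add_le) fact
    also have "\<dots> = ennreal (2 powr p) * (ennreal (r powr p) * epowr (maximal g x) p + ennreal (F x powr p))"
      using assms by (simp add: epowr_mult)
    finally have "epowr (maximal f x) p * ennreal (w x) \<le> \<dots> * ennreal (w x)"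
      by (rule mult_right_mono) simp
    then show "epowr (maximal f x) p * ennreal (w x) \<le> ennreal (2 powr p * r powr p) * (epowr (maximal g x) p * ennreal (w x))
      + ennreal (2 powr p) * ennreal (F x powr p * w x)"
      using assms by (simp add: ennreal_mult algebra_simps)
  qed
  also have "\<dots> = ennreal (2 powr p * r powr p) * MLp_pow p w g
    + ennreal (2 powr p) * (\<integral>\<^sup>+ x. ennreal (F x powr p * w x) \<partial>lebesgue)"
    unfolding MLp_pow_def
    by (subst nn_integral_add, measurable, subst nn_integral_cmult, measurable, subst nn_integral_cmult, measurable)
  finally show ?thesis .
qed

section \<open>Discretization on a grid, absorption, and the resulting inequalities\<close>

context MLp_bounded_nondegenerate
begin

text \<open>The mass of \<open>f\<close> in every cell of a grid of mesh \<open>\<epsilon>\<close> is concentrated near a corner of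
  that cell; \<open>F\<close> controls the oscillation of \<open>f\<close> at scale \<open>\<epsilon>\<close>.\<close>
lemma grid_estimate:
  fixes f F :: "'a \<Rightarrow> real" and N :: nat
  assumes f: "test_fun f" "\<And>x. 0 \<le> f x" and F: "\<And>x. 0 \<le> F x" and \<epsilon>: "0 < \<epsilon>" and N: "0 < N"
    and near: "\<And>x y. (\<And>i. i \<in> Basis \<Longrightarrow> \<bar>y \<bullet> i - x \<bullet> i\<bar> \<le> 2 * \<epsilon>) \<Longrightarrow> f y \<le> F x"
  obtains g H where
    "\<And>x. maximal g x \<le> ennreal (3 ^ DIM('a)) * maximal f x + ennreal ((4 ^ N) ^ DIM('a) * F x)"
    "\<And>x. maximal f x \<le> ennreal (3 ^ DIM('a) / real N) * maximal H x + ennreal (F x)"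
    "MLp_pow p w H \<le> ennreal ((4 * c0\<^sup>2 * C\<^sup>2) powr p) * MLp_pow p w g"
proof -
  let ?q = "grid_point \<epsilon> :: 'a \<Rightarrow> 'a"
  note [measurable] = test_fun_measurable[OF f(1)] borel_measurable_grid_point
  define A where "A = ?q ` {x. f x \<noteq> 0}"
  have "finite A"
    unfolding A_def using f(1) by (intro finite_grid_points) (simp add: test_fun_def)
  have separated: "\<exists>i\<in>Basis. \<epsilon> \<le> \<bar>a \<bullet> i - b \<bullet> i\<bar>" if "a \<in> A" "b \<in> A" "a \<noteq> b" for a b
    using that grid_point_separated[OF _ \<epsilon>] unfolding A_def by blast
  have unique: "a = b" if ab: "a \<in> A" "b \<in> A" "x \<in> cube a s" "x \<in> cube b s" "s < \<epsilon>" for a b x s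
  proof (rule ccontr)
    assume "a \<noteq> b"
    then obtain i where "i \<in> Basis" "\<epsilon> \<le> \<bar>a \<bullet> i - b \<bullet> i\<bar>"
      using separated ab(1,2) by blast
    moreover from this have "a \<bullet> i \<le> x \<bullet> i \<and> x \<bullet> i \<le> a \<bullet> i + s" "b \<bullet> i \<le> x \<bullet> i \<and> x \<bullet> i \<le> b \<bullet> i + s"
      using ab by (auto simp: mem_cube)
    ultimately show False
      using ab(5) by linarith
  qed
  \<comment> \<open>Cells are fibres of \<open>?q\<close> and not closed cubes, so that mass on
    common faces is counted once.\<close>
  define P where "P a = ?q -` {a}" for a
  have P_meas [measurable]: "P a \<in> sets lebesgue" for a
    using measurable_sets[OF borel_measurable_grid_point, of "{a}" \<epsilon>] by (simp add: P_def)
  have P_subset: "P a \<subseteq> cube a \<epsilon>" for a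
    unfolding P_def using mem_cube_grid_point[OF \<epsilon>] by auto
  define c where "c a = (\<integral>x. indicator (P a) x * f x \<partial>lebesgue)" for a
  have c_nonneg: "0 \<le> c a" for a
    unfolding c_def using f(2) by (intro integral_nonneg_AE) auto
  have c_nn: "ennreal (c a) = (\<integral>\<^sup>+ x \<in> P a. ennreal (f x) \<partial>lebesgue)" for a
  proof -
    have "test_fun (\<lambda>x. indicator (P a) x * f x)"
      by (rule test_fun_le[OF _ f(1)]) (measurable, simp add: indicator_def)
    then have "(\<integral>\<^sup>+ x. ennreal (indicator (P a) x * f x) \<partial>lebesgue) = ennreal (c a)"
      unfolding c_def using f(2) by (intro nn_integral_eq_integral integrable_test_fun) auto
    moreover have "(\<integral>\<^sup>+ x. ennreal (indicator (P a) x * f x) \<partial>lebesgue) = (\<integral>\<^sup>+ x \<in> P a. ennreal (f x) \<partial>lebesgue)"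
      by (intro nn_integral_cong) (simp add: indicator_def)
    ultimately show ?thesis by simp
  qed
  define l where "l = \<epsilon> / 4 ^ N"
  have l: "0 < l" "l < \<epsilon>"
  proof -
    have "(1::real) < 4 ^ N"
      using N by simp
    then show "0 < l" "l < \<epsilon>"
      using \<epsilon> by (auto simp: l_def field_simps)
  qed
  define g where "g x = (\<Sum>a\<in>A. c a / l ^ DIM('a) * indicator (cube a l) x)" for x
  have g_nonneg: "0 \<le> g x" for x
    unfolding g_def using c_nonneg l by (intro sum_nonneg) auto
  obtain H where H [measurable]: "H \<in> borel_measurable lebesgue" and H_nonneg: "\<And>x. 0 \<le> H x"
    and H_mass: "\<And>a. a \<in> A \<Longrightarrow> ennreal (real N * c a) \<le> (\<integral>\<^sup>+ x \<in> cube a (\<epsilon> / 4). ennreal (H x) \<partial>lebesgue)"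
    and H_MLp: "MLp_pow p w H \<le> ennreal ((4 * c0\<^sup>2 * C\<^sup>2) powr p) * MLp_pow p w g"
  proof -
    have "\<exists>H \<in> borel_measurable lebesgue. (\<forall>x. 0 \<le> H x) \<and>
      (\<forall>a\<in>A. ennreal (real N * c a) \<le> (\<integral>\<^sup>+ x \<in> cube a (\<epsilon> / 4). ennreal (H x) \<partial>lebesgue)) \<and>
      MLp_pow p w H \<le> ennreal ((4 * c0\<^sup>2 * C\<^sup>2) powr p) * MLp_pow p w g"
      unfolding g_def[abs_def] l_def by (rule mass_amplification[OF \<epsilon> \<open>finite A\<close> c_nonneg separated])
    then show ?thesis
      using that by blast
  qed

  \<comment> \<open>Concentrating a cell of side \<epsilon> to side \<open>l\<close> multiplies its
    mean density by (4^N)^n. That mean is at most \<open>F x\<close>, because all points of the cell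
    are within 2\<epsilon> of \<open>x\<close> in each coordinate: \<epsilon> inside the cell and at
    most \<epsilon> inside the cube \<open>cube b s\<close>.\<close>
  have small: "g y \<le> (4 ^ N) ^ DIM('a) * F x"
    if "x \<in> cube b s" "y \<in> cube b s" "s \<le> \<epsilon>" for x y b s
  proof (cases "\<exists>a\<in>A. y \<in> cube a l")
    case False
    then have "g y = 0"
      unfolding g_def by (intro sum.neutral) auto
    then show ?thesis using F[of x] by simp
  next
    case True
    then obtain a where a: "a \<in> A" "y \<in> cube a l" by blast
    have "c b' / l ^ DIM('a) * indicator (cube b' l) y = 0" if "b' \<in> A" "b' \<noteq> a" for b'
    proof -
      have "y \<notin> cube b' l"
        using unique[OF that(1) a(1) _ a(2) l(2)] that(2) by blast
      then show ?thesis by simp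
    qed
    then have "g y = c a / l ^ DIM('a)"
      unfolding g_def using a by (subst sum_single[OF \<open>finite A\<close> a(1)]) auto
    have "ennreal (c a) \<le> (\<integral>\<^sup>+ z \<in> cube a \<epsilon>. ennreal (F x) \<partial>lebesgue)"
      unfolding c_nn
    proof (rule nn_integral_mono)
      fix z
      have "f z \<le> F x" if "z \<in> cube a \<epsilon>"
      proof (rule near)
        fix i :: 'a assume i: "i \<in> Basis"
        have "y \<in> cube a \<epsilon>"
          using a(2) cube_mono[of l \<epsilon>] l by auto
        then have "a \<bullet> i \<le> y \<bullet> i \<and> y \<bullet> i \<le> a \<bullet> i + \<epsilon>" "a \<bullet> i \<le> z \<bullet> i \<and> z \<bullet> i \<le> a \<bullet> i + \<epsilon>"
          "b \<bullet> i \<le> y \<bullet> i \<and> y \<bullet> i \<le> b \<bullet> i + s" "b \<bullet> i \<le> x \<bullet> i \<and> x \<bullet> i \<le> b \<bullet> i + s"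
          using i that \<open>x \<in> cube b s\<close> \<open>y \<in> cube b s\<close> by (auto simp: mem_cube)
        then show "\<bar>z \<bullet> i - x \<bullet> i\<bar> \<le> 2 * \<epsilon>"
          using \<open>s \<le> \<epsilon>\<close> by linarith
      qed
      then show "ennreal (f z) * indicator (P a) z \<le> ennreal (F x) * indicator (cube a \<epsilon>) z"
        using P_subset[of a] by (auto simp: indicator_def intro: ennreal_leI)
    qed
    also have "\<dots> = ennreal (F x) * emeasure lebesgue (cube a \<epsilon>)"
      by (rule nn_integral_cmult_indicator) simp
    also have "\<dots> = ennreal (F x * \<epsilon> ^ DIM('a))"
      using \<epsilon> F[of x] by (subst emeasure_cube) (auto simp: ennreal_mult)
    finally have "c a \<le> F x * \<epsilon> ^ DIM('a)"
      using F[of x] \<epsilon> by (subst (asm) ennreal_le_iff) auto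
    then show ?thesis
      unfolding \<open>g y = c a / l ^ DIM('a)\<close> using \<epsilon> by (simp add: l_def field_simps)
  qed

  have "maximal g x \<le> ennreal (3 ^ DIM('a)) * maximal f x + ennreal ((4 ^ N) ^ DIM('a) * F x)" for x
  proof (rule maximal_leI)
    fix b s assume bs: "0 < s" "x \<in> cube b s"
    show "cube_avg g b s \<le> ennreal (3 ^ DIM('a)) * maximal f x + ennreal ((4 ^ N) ^ DIM('a) * F x)"
    proof (cases "s \<le> \<epsilon>")
      case True
      then have "cube_avg g b s \<le> ennreal ((4 ^ N) ^ DIM('a) * F x)"
        using small[OF bs(2)] g_nonneg by (intro cube_avg_le_const bs) auto
      then show ?thesis
        by (simp add: add_increasing)
    next
      case False
      \<comment> \<open>For a cube larger than the mesh, every cell whose concentrated part meets it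
        lies in the cube enlarged by \<epsilon> on each side. The new side is at most 3 s, whence
        3^n.\<close>
      define B where "B = {a\<in>A. cube a l \<inter> cube b s \<noteq> {}}"
      have "finite B"
        using \<open>finite A\<close> by (simp add: B_def)
      let ?R = "cube (b - \<epsilon> *\<^sub>R One) (s + 2 * \<epsilon>)"
      have "(\<integral>\<^sup>+ y \<in> cube b s. ennreal \<bar>g y\<bar> \<partial>lebesgue)
        \<le> (\<integral>\<^sup>+ y. (\<Sum>a\<in>B. ennreal (c a / l ^ DIM('a)) * indicator (cube a l) y) \<partial>lebesgue)"
      proof (rule nn_integral_mono)
        fix y
        show "ennreal \<bar>g y\<bar> * indicator (cube b s) y \<le> (\<Sum>a\<in>B. ennreal (c a / l ^ DIM('a)) * indicator (cube a l) y)"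
        proof (cases "y \<in> cube b s")
          case True
          have "g y = (\<Sum>a\<in>B. c a / l ^ DIM('a) * indicator (cube a l) y)"
            unfolding g_def B_def using True \<open>finite A\<close> by (intro sum.mono_neutral_right) (auto simp: indicator_def)
          then have "ennreal \<bar>g y\<bar> = ennreal (\<Sum>a\<in>B. c a / l ^ DIM('a) * indicator (cube a l) y)"
            using g_nonneg[of y] by simp
          also have "\<dots> = (\<Sum>a\<in>B. ennreal (c a / l ^ DIM('a) * indicator (cube a l) y))"
            using c_nonneg l by (intro sum_ennreal[symmetric]) auto
          also have "\<dots> = (\<Sum>a\<in>B. ennreal (c a / l ^ DIM('a)) * indicator (cube a l) y)"
            by (intro sum.cong) (auto simp: indicator_def)
          finally show ?thesis using True by simp
        qed simp
      qed
      also have "\<dots> = (\<Sum>a\<in>B. ennreal (c a / l ^ DIM('a)) * emeasure lebesgue (cube a l))"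
        by (subst nn_integral_sum) (auto simp: nn_integral_cmult_indicator)
      also have "\<dots> = (\<Sum>a\<in>B. \<integral>\<^sup>+ x \<in> P a. ennreal (f x) \<partial>lebesgue)"
        unfolding c_nn[symmetric] using l c_nonneg
        by (intro sum.cong refl, subst emeasure_cube) (auto simp: ennreal_mult[symmetric])
      also have "\<dots> \<le> (\<integral>\<^sup>+ x \<in> ?R. ennreal (f x) \<partial>lebesgue)"
      proof (rule sum_nn_integral_disjoint_le[OF \<open>finite B\<close>])
        fix a assume "a \<in> B"
        then obtain z where z: "z \<in> cube a l" "z \<in> cube b s"
          by (auto simp: B_def)
        show "P a \<subseteq> ?R"
        proof
          fix y assume "y \<in> P a"
          then have y: "y \<in> cube a \<epsilon>"
            using P_subset by blast
          have "b \<bullet> i - \<epsilon> \<le> y \<bullet> i \<and> y \<bullet> i \<le> b \<bullet> i - \<epsilon> + (s + 2 * \<epsilon>)" if "i \<in> Basis" for i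
          proof -
            have "a \<bullet> i \<le> z \<bullet> i \<and> z \<bullet> i \<le> a \<bullet> i + l" "b \<bullet> i \<le> z \<bullet> i \<and> z \<bullet> i \<le> b \<bullet> i + s"
              "a \<bullet> i \<le> y \<bullet> i \<and> y \<bullet> i \<le> a \<bullet> i + \<epsilon>"
              using z y that by (auto simp: mem_cube)
            then show ?thesis using l by linarith
          qed
          then show "y \<in> ?R"
            unfolding mem_cube inner_diff_left inner_scaleR_left by simp
        qed
      qed (use P_meas in \<open>auto simp: P_def\<close>)
      finally have "(\<integral>\<^sup>+ y \<in> cube b s. ennreal \<bar>g y\<bar> \<partial>lebesgue) \<le> 1 * (\<integral>\<^sup>+ x \<in> ?R. ennreal \<bar>f x\<bar> \<partial>lebesgue)"
        using f(2) by simp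
      then have "cube_avg g b s \<le> ennreal (3 ^ DIM('a)) * 1 * cube_avg f (b - \<epsilon> *\<^sub>R One) (s + 2 * \<epsilon>)"
        using bs \<epsilon> False by (intro cube_avg_compare) auto
      also have "\<dots> \<le> ennreal (3 ^ DIM('a)) * 1 * maximal f x"
        using interior_cube_mem[OF bs(2) \<epsilon>] bs \<epsilon> box_subset_cbox
        by (intro mult_left_mono cube_avg_le_maximal) (auto simp: cube_def)
      finally show ?thesis
        by (simp add: add_increasing2)
    qed
  qed
  moreover have "maximal f x \<le> ennreal (3 ^ DIM('a) / real N) * maximal H x + ennreal (F x)" for x
  proof (rule maximal_leI)
    fix b s assume bs: "0 < s" "x \<in> cube b s"
    show "cube_avg f b s \<le> ennreal (3 ^ DIM('a) / real N) * maximal H x + ennreal (F x)"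
    proof (cases "s \<le> \<epsilon>")
      case True
      have "f y \<le> F x" if y: "y \<in> cube b s" for y
      proof (rule near)
        fix i :: 'a assume "i \<in> Basis"
        then have "b \<bullet> i \<le> y \<bullet> i \<and> y \<bullet> i \<le> b \<bullet> i + s" "b \<bullet> i \<le> x \<bullet> i \<and> x \<bullet> i \<le> b \<bullet> i + s"
          using y bs by (auto simp: mem_cube)
        then show "\<bar>y \<bullet> i - x \<bullet> i\<bar> \<le> 2 * \<epsilon>"
          using True \<epsilon> by linarith
      qed
      then have "cube_avg f b s \<le> ennreal (F x)"
        using f(2) by (intro cube_avg_le_const bs) auto
      then show ?thesis
        by (simp add: add_increasing)
    next
      case False
      \<comment> \<open>Here \<open>B\<close> collects the cells that meet the cube and carry mass
        of \<open>f\<close>. Each mass is replaced by 1/N times the integral of \<open>H\<close>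
        over \<open>cube a (\<epsilon> / 4)\<close>; these cubes are disjoint and lie in the
        enlarged cube, so the gain survives summation.\<close>
      define B where "B = A \<inter> ?q ` cube b s"
      have "finite B"
        using \<open>finite A\<close> by (simp add: B_def)
      let ?R = "cube (b - \<epsilon> *\<^sub>R One) (s + 2 * \<epsilon>)"
      have "(\<integral>\<^sup>+ y \<in> cube b s. ennreal \<bar>f y\<bar> \<partial>lebesgue)
        \<le> (\<integral>\<^sup>+ y. (\<Sum>a\<in>B. ennreal (f y) * indicator (P a) y) \<partial>lebesgue)"
      proof (rule nn_integral_mono)
        fix y
        show "ennreal \<bar>f y\<bar> * indicator (cube b s) y \<le> (\<Sum>a\<in>B. ennreal (f y) * indicator (P a) y)"
        proof (cases "y \<in> cube b s \<and> f y \<noteq> 0")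
          case True
          then have "?q y \<in> B"
            by (auto simp: B_def A_def)
          then have "ennreal (f y) * indicator (P (?q y)) y \<le> (\<Sum>a\<in>B. ennreal (f y) * indicator (P a) y)"
            using \<open>finite B\<close> by (intro member_le_sum) auto
          then show ?thesis
            using f(2)[of y] True by (simp add: P_def)
        qed (auto simp: indicator_def)
      qed
      also have "\<dots> = (\<Sum>a\<in>B. ennreal (c a))"
        unfolding c_nn by (rule nn_integral_sum) measurable
      also have "\<dots> = (\<Sum>a\<in>B. ennreal (1 / real N) * ennreal (real N * c a))"
        using N c_nonneg by (intro sum.cong refl, subst ennreal_mult[symmetric]) auto
      also have "\<dots> \<le> (\<Sum>a\<in>B. ennreal (1 / real N) * (\<integral>\<^sup>+ x \<in> cube a (\<epsilon> / 4). ennreal (H x) \<partial>lebesgue))"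
        by (intro sum_mono mult_left_mono H_mass) (auto simp: B_def)
      also have "\<dots> = ennreal (1 / real N) * (\<Sum>a\<in>B. \<integral>\<^sup>+ x \<in> cube a (\<epsilon> / 4). ennreal (H x) \<partial>lebesgue)"
        by (simp add: sum_distrib_left)
      also have "\<dots> \<le> ennreal (1 / real N) * (\<integral>\<^sup>+ x \<in> ?R. ennreal (H x) \<partial>lebesgue)"
      proof (intro mult_left_mono sum_nn_integral_disjoint_le[OF \<open>finite B\<close>])
        fix a assume "a \<in> B"
        then obtain z where z: "a = ?q z" "z \<in> cube b s"
          by (auto simp: B_def)
        show "cube a (\<epsilon> / 4) \<subseteq> ?R"
        proof
          fix y assume y: "y \<in> cube a (\<epsilon> / 4)"
          have "b \<bullet> i - \<epsilon> \<le> y \<bullet> i \<and> y \<bullet> i \<le> b \<bullet> i - \<epsilon> + (s + 2 * \<epsilon>)" if "i \<in> Basis" for i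
          proof -
            have "a \<bullet> i \<le> z \<bullet> i \<and> z \<bullet> i \<le> a \<bullet> i + \<epsilon>" "b \<bullet> i \<le> z \<bullet> i \<and> z \<bullet> i \<le> b \<bullet> i + s"
              "a \<bullet> i \<le> y \<bullet> i \<and> y \<bullet> i \<le> a \<bullet> i + \<epsilon> / 4"
              using z y that mem_cube_grid_point[OF \<epsilon>, of z] by (auto simp: mem_cube)
            then show ?thesis using \<epsilon> by linarith
          qed
          then show "y \<in> ?R"
            unfolding mem_cube inner_diff_left inner_scaleR_left by simp
        qed
      next
        fix a b x assume "a \<in> B" "b \<in> B" "x \<in> cube a (\<epsilon> / 4)" "x \<in> cube b (\<epsilon> / 4)"
        then show "a = b"
          using \<epsilon> by (intro unique[of a b x "\<epsilon> / 4"]) (auto simp: B_def)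
      qed auto
      finally have "(\<integral>\<^sup>+ y \<in> cube b s. ennreal \<bar>f y\<bar> \<partial>lebesgue) \<le> ennreal (1 / real N) * (\<integral>\<^sup>+ x \<in> ?R. ennreal \<bar>H x\<bar> \<partial>lebesgue)"
        using H_nonneg by simp
      then have "cube_avg f b s \<le> ennreal (3 ^ DIM('a)) * ennreal (1 / real N) * cube_avg H (b - \<epsilon> *\<^sub>R One) (s + 2 * \<epsilon>)"
        using bs \<epsilon> False by (intro cube_avg_compare) auto
      also have "\<dots> \<le> ennreal (3 ^ DIM('a)) * ennreal (1 / real N) * maximal H x"
        using interior_cube_mem[OF bs(2) \<epsilon>] bs \<epsilon> box_subset_cbox
        by (intro mult_left_mono cube_avg_le_maximal) (auto simp: cube_def)
      also have "ennreal (3 ^ DIM('a)) * ennreal (1 / real N) = ennreal (3 ^ DIM('a) / real N)"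
        by (subst ennreal_mult[symmetric]) auto
      finally show ?thesis
        by (simp add: add_increasing2)
    qed
  qed
  ultimately show ?thesis
    using H_MLp by (rule that)
qed

lemma integrable_w_compact: "compact S \<Longrightarrow> integrable lebesgue (\<lambda>x. indicator S x * w x)"
  using w_loc_integrable by (simp add: loc_integrable_def set_integrable_def)

text \<open>The gain \<open>N\<close> of \<open>grid_estimate\<close> beats all the other constants, so that the maximal
  function of \<open>f\<close> on the right can be absorbed; its norm is finite because \<open>w\<close> is in \<open>N\<^sub>p\<close>.\<close>
lemma absorption:
  obtains K where "0 < K"
    "\<And>f F \<epsilon>. \<lbrakk>test_fun f; \<And>x. 0 \<le> f x; F \<in> borel_measurable lebesgue; \<And>x. 0 \<le> F x; 0 < \<epsilon>;
      \<And>x y. (\<And>i. i \<in> Basis \<Longrightarrow> \<bar>y \<bullet> i - x \<bullet> i\<bar> \<le> 2 * \<epsilon>) \<Longrightarrow> f y \<le> F x\<rbrakk>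
      \<Longrightarrow> MLp_pow p w f \<le> ennreal K * (\<integral>\<^sup>+ x. ennreal (F x powr p * w x) \<partial>lebesgue)"
proof -
  define D where "D = 4 * c0\<^sup>2 * C\<^sup>2"
  define E where "E = (3::real) ^ DIM('a)"
  have pos: "0 < D" "0 < E"
    using c0 C by (auto simp: D_def E_def)
  \<comment> \<open>The norm of \<open>f\<close> will return with factor (4 E^2 D / N)^p, so this
    \<open>N\<close> makes the base less than 1/2, and p > 1 then keeps the power at most
    1/2.\<close>
  obtain N :: nat where N: "8 * E * E * D < real N"
    using reals_Archimedean2 by blast
  have "0 < 8 * E * E * D"
    using pos by simp
  with N have "0 < N"
    by (metis of_nat_0_less_iff order_less_trans)
  \<comment> \<open>Enormous once \<open>N\<close> is fixed, but it multiplies only \<open>F\<close>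
    and so goes into the final constant.\<close>
  define B where "B = ((4::real) ^ N) ^ DIM('a)"
  have "0 < B"
    by (simp add: B_def)
  define k where "k = 2 powr p * (E / real N) powr p * D powr p"
  have "0 \<le> k"
    by (simp add: k_def)
  have k: "k * (2 powr p * E powr p) \<le> 1 / 2"
  proof -
    have "k * (2 powr p * E powr p) = (2 * (E / real N) * D * (2 * E)) powr p"
      by (simp only: k_def powr_mult mult.assoc)
    also have "\<dots> \<le> (1 / 2) powr p"
      using N p pos \<open>0 < N\<close> by (intro powr_mono2) (auto simp: field_simps)
    also have "\<dots> \<le> (1 / 2) powr 1"
      using p by (intro powr_mono') auto
    finally show ?thesis by simp
  qed
  define K1 where "K1 = k * (2 powr p * B powr p) + 2 powr p"
  have "0 < K1"
    using \<open>0 \<le> k\<close> by (auto simp: K1_def intro!: add_nonneg_pos)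
  have "MLp_pow p w f \<le> ennreal (2 * K1) * (\<integral>\<^sup>+ x. ennreal (F x powr p * w x) \<partial>lebesgue)"
    if f: "test_fun f" "\<And>x. 0 \<le> f x" and F [measurable]: "F \<in> borel_measurable lebesgue" and F_nonneg: "\<And>x. 0 \<le> F x"
      and \<epsilon>: "0 < \<epsilon>"
      and near: "\<And>x y. (\<And>i. i \<in> Basis \<Longrightarrow> \<bar>y \<bullet> i - x \<bullet> i\<bar> \<le> 2 * \<epsilon>) \<Longrightarrow> f y \<le> F x" for f F \<epsilon>
  proof -
    let ?\<Phi> = "\<integral>\<^sup>+ x. ennreal (F x powr p * w x) \<partial>lebesgue"
    obtain g H where
      gf: "\<And>x. maximal g x \<le> ennreal E * maximal f x + ennreal (B * F x)" and
      fH: "\<And>x. maximal f x \<le> ennreal (E / real N) * maximal H x + ennreal (F x)" and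
      Hg: "MLp_pow p w H \<le> ennreal (D powr p) * MLp_pow p w g"
      by (rule grid_estimate[where F=F and N=N, OF f F_nonneg \<epsilon> \<open>0 < N\<close> near, folded E_def B_def D_def]) (blast, rule that)
    have "MLp_pow p w g \<le> ennreal (2 powr p * E powr p) * MLp_pow p w f
        + ennreal (2 powr p) * (\<integral>\<^sup>+ x. ennreal ((B * F x) powr p * w x) \<partial>lebesgue)"
      using pos p F_nonneg \<open>0 < B\<close> w_nonneg by (intro MLp_pow_le_of_maximal_le gf) auto
    also have "(\<integral>\<^sup>+ x. ennreal ((B * F x) powr p * w x) \<partial>lebesgue)
        = (\<integral>\<^sup>+ x. ennreal (B powr p) * ennreal (F x powr p * w x) \<partial>lebesgue)"
      using w_nonneg by (intro nn_integral_cong) (simp add: powr_mult ennreal_mult[symmetric] mult.assoc)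
    also have "\<dots> = ennreal (B powr p) * ?\<Phi>"
      by (rule nn_integral_cmult) measurable
    finally have g: "MLp_pow p w g \<le> ennreal (2 powr p * E powr p) * MLp_pow p w f
        + ennreal (2 powr p * B powr p) * ?\<Phi>"
      by (simp add: ennreal_mult mult.assoc)
    \<comment> \<open>The circle closes: \<open>f\<close> is bounded by \<open>H\<close>,
      \<open>H\<close> by \<open>g\<close>, and \<open>g\<close> again by \<open>f\<close>, with an
      error in \<open>F\<close> at the two comparisons made on the grid.\<close>
    have "MLp_pow p w f \<le> ennreal (2 powr p * (E / real N) powr p) * MLp_pow p w H + ennreal (2 powr p) * ?\<Phi>"
      using pos p F_nonneg \<open>0 < N\<close> w_nonneg by (intro MLp_pow_le_of_maximal_le fH) auto
    also have "\<dots> \<le> ennreal (2 powr p * (E / real N) powr p) * (ennreal (D powr p) * MLp_pow p w g) + ennreal (2 powr p) * ?\<Phi>"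
      by (intro add_mono mult_left_mono Hg) auto
    also have "\<dots> = ennreal k * MLp_pow p w g + ennreal (2 powr p) * ?\<Phi>"
      by (simp add: k_def ennreal_mult mult.assoc)
    also have "\<dots> \<le> ennreal k * (ennreal (2 powr p * E powr p) * MLp_pow p w f
        + ennreal (2 powr p * B powr p) * ?\<Phi>) + ennreal (2 powr p) * ?\<Phi>"
      by (intro add_mono mult_left_mono g) auto
    also have "\<dots> = ennreal (k * (2 powr p * E powr p)) * MLp_pow p w f + ennreal K1 * ?\<Phi>"
      using \<open>0 \<le> k\<close> by (simp add: K1_def ennreal_mult algebra_simps)
    also have "\<dots> \<le> ennreal (1 / 2) * MLp_pow p w f + ennreal K1 * ?\<Phi>"
      by (intro add_mono mult_right_mono ennreal_leI k) auto
    finally have le: "MLp_pow p w f \<le> ennreal (1 / 2) * MLp_pow p w f + ennreal K1 * ?\<Phi>" .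
    have "MLp_pow p w f < top"
      using f(1) Np p by (intro MLp_pow_test_fun_finite) auto
    then obtain m where m: "MLp_pow p w f = ennreal m" "0 \<le> m"
      by (cases "MLp_pow p w f") auto
    show ?thesis
    proof (cases "?\<Phi>")
      case (real r)
      have "ennreal m \<le> ennreal (m / 2 + K1 * r)"
        using le m(2) real \<open>0 < K1\<close> ennreal_half[OF m(2)] unfolding m real(2)
        by (simp add: ennreal_mult[symmetric] ennreal_plus[symmetric] del: ennreal_plus)
      then have "m \<le> m / 2 + K1 * r"
        using m(2) real(1) \<open>0 < K1\<close> by (subst (asm) ennreal_le_iff) auto
      then have "ennreal m \<le> ennreal (2 * K1 * r)"
        by (intro ennreal_leI) simp
      then show ?thesis
        unfolding m real(2) using \<open>0 < K1\<close> real(1) by (simp add: ennreal_mult)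
    next
      case top
      then show ?thesis
        using \<open>0 < K1\<close> by (simp add: ennreal_mult_top)
    qed
  qed
  with \<open>0 < K1\<close> show ?thesis
    by (intro that[of "2 * K1"]) auto
qed

text \<open>The constant of \<open>absorption\<close> does not depend on the mesh. For continuous
  \<open>f\<close>, refining the mesh lets the majorant \<open>F\<close> decrease to
  \<open>f\<close> by uniform continuity, and dominated convergence passes to the limit.\<close>

lemma strong_type_continuous:
  obtains K where "0 < K"
    "\<And>f. \<lbrakk>continuous_on UNIV f; bounded {x. f x \<noteq> 0}; \<And>x. 0 \<le> f x\<rbrakk> \<Longrightarrow>
      MLp_pow p w f \<le> ennreal K * (\<integral>\<^sup>+ x. ennreal (f x powr p * w x) \<partial>lebesgue)"
proof -
  obtain K where K: "0 < K" and absorb: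
    "\<And>f F \<epsilon>. \<lbrakk>test_fun f; \<And>x. 0 \<le> f x; F \<in> borel_measurable lebesgue; \<And>x. 0 \<le> F x; 0 < \<epsilon>;
      \<And>x y. (\<And>i. i \<in> Basis \<Longrightarrow> \<bar>y \<bullet> i - x \<bullet> i\<bar> \<le> 2 * \<epsilon>) \<Longrightarrow> f y \<le> F x\<rbrakk>
      \<Longrightarrow> MLp_pow p w f \<le> ennreal K * (\<integral>\<^sup>+ x. ennreal (F x powr p * w x) \<partial>lebesgue)"
    using absorption by blast
  have "MLp_pow p w f \<le> ennreal K * (\<integral>\<^sup>+ x. ennreal (f x powr p * w x) \<partial>lebesgue)"
    if cont: "continuous_on UNIV f" and supp: "bounded {x. f x \<noteq> 0}" and nonneg: "\<And>x. 0 \<le> f x" for f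
  proof -
    have test: "test_fun f"
      using cont supp by (rule test_fun_continuous)
    note [measurable] = test_fun_measurable[OF test]
    obtain B R where B: "\<And>x. \<bar>f x\<bar> \<le> B" and R: "\<And>x. f x \<noteq> 0 \<Longrightarrow> norm x \<le> R"
      using test by (auto simp: test_fun_def bounded_iff)
    have "0 \<le> B" using B[of 0] by simp
    define S where "S = cball (0::'a) (R + 1)"
    have [measurable]: "S \<in> sets lebesgue"
      by (simp add: S_def)
    \<comment> \<open>The allowance 1/(m+1) is needed only near the support. The ball reaches one
      unit beyond it, and the mesh is chosen so that neighbouring points are at distance at most
      1.\<close>
    define F where "F m x = f x + 1 / real (Suc m) * indicator S x" for m x
    have [measurable]: "F m \<in> borel_measurable lebesgue" for m
      unfolding F_def[abs_def] by measurable
    have F_nonneg: "0 \<le> F m x" for m x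
      using nonneg by (simp add: F_def)
    have "MLp_pow p w f \<le> ennreal K * (\<integral>\<^sup>+ x. ennreal (F m x powr p * w x) \<partial>lebesgue)" for m
    proof -
      have "uniformly_continuous_on (cball (0::'a) (R + 2)) f"
        by (intro compact_uniformly_continuous continuous_on_subset[OF cont]) auto
      then obtain d where d: "0 < d" "\<And>x y. \<lbrakk>x \<in> cball 0 (R + 2); y \<in> cball 0 (R + 2); dist y x < d\<rbrakk> \<Longrightarrow> dist (f y) (f x) < 1 / real (Suc m)"
        unfolding uniformly_continuous_on_def by (metis of_nat_0_less_iff zero_less_Suc zero_less_divide_1_iff)
      \<comment> \<open>Coordinates within 2\<epsilon> give distance at most 2 n \<epsilon>, which
        is half of min d 1.\<close>
      define \<epsilon> where "\<epsilon> = min d 1 / (4 * real DIM('a))"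
      have "0 < \<epsilon>"
        using d(1) by (simp add: \<epsilon>_def)
      have \<epsilon>: "real DIM('a) * (2 * \<epsilon>) < d" "real DIM('a) * (2 * \<epsilon>) \<le> 1"
        using d(1) by (auto simp: \<epsilon>_def)
      show ?thesis
      proof (rule absorb[OF test nonneg _ F_nonneg \<open>0 < \<epsilon>\<close>])
        fix x y :: 'a
        assume "\<And>i. i \<in> Basis \<Longrightarrow> \<bar>y \<bullet> i - x \<bullet> i\<bar> \<le> 2 * \<epsilon>"
        then have "norm (y - x) \<le> real DIM('a) * (2 * \<epsilon>)"
          by (rule norm_le_coordinates)
        with \<epsilon> have yx: "norm (y - x) < d" "norm (y - x) \<le> 1"
          by linarith+
        show "f y \<le> F m x"
        proof (cases "x \<in> S")
          case True
          then have "x \<in> cball 0 (R + 2)" "y \<in> cball 0 (R + 2)"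
            using yx(2) norm_triangle_sub[of y x] by (auto simp: S_def)
          from d(2)[OF this] yx(1) have "\<bar>f y - f x\<bar> < 1 / real (Suc m)"
            by (simp add: dist_norm)
          then show ?thesis
            using True by (simp add: F_def)
        next
          case False
          then have "\<not> norm y \<le> R"
            using yx(2) norm_triangle_sub[of x y] by (auto simp: S_def norm_minus_commute)
          then show ?thesis
            using R[of y] F_nonneg[of m x] by (cases "f y = 0") auto
        qed
      qed measurable
    qed
    moreover have "(\<lambda>m. \<integral>\<^sup>+ x. ennreal (F m x powr p * w x) \<partial>lebesgue) \<longlonglongrightarrow> (\<integral>\<^sup>+ x. ennreal (f x powr p * w x) \<partial>lebesgue)"
    proof (rule nn_integral_dominated_convergence[where w="\<lambda>x. ennreal ((B + 1) powr p * (indicator S x * w x))"])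
      show "AE x in lebesgue. ennreal (F m x powr p * w x) \<le> ennreal ((B + 1) powr p * (indicator S x * w x))" for m
      proof (rule AE_I2)
        fix x
        have "F m x powr p * w x \<le> (B + 1) powr p * (indicator S x * w x)"
        proof (cases "x \<in> S")
          case True
          have "1 / real (Suc m) \<le> 1"
            by simp
          moreover have "F m x = f x + 1 / real (Suc m)"
            using True by (simp add: F_def)
          ultimately have "F m x \<le> B + 1"
            using B[of x] by linarith
          then show ?thesis
            using True F_nonneg p w_nonneg by (auto intro!: mult_right_mono powr_mono2)
        next
          case False
          then have "f x = 0"
            using R[of x] by (force simp: S_def)
          then show ?thesis
            using False by (simp add: F_def)
        qed
        then show "ennreal (F m x powr p * w x) \<le> ennreal ((B + 1) powr p * (indicator S x * w x))"
          by (rule ennreal_leI)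
      qed
      have "integrable lebesgue (\<lambda>x. (B + 1) powr p * (indicator S x * w x))"
        by (intro integrable_mult_right integrable_w_compact) (simp add: S_def)
      then show "(\<integral>\<^sup>+ x. ennreal ((B + 1) powr p * (indicator S x * w x)) \<partial>lebesgue) < \<infinity>"
        using w_nonneg by (subst nn_integral_eq_integral) auto
      show "AE x in lebesgue. (\<lambda>m. ennreal (F m x powr p * w x)) \<longlonglongrightarrow> ennreal (f x powr p * w x)"
      proof (intro AE_I2 tendsto_ennrealI tendsto_mult tendsto_const)
        fix x
        have "(\<lambda>m. f x + 1 / real (Suc m) * indicator S x) \<longlonglongrightarrow> f x + 0 * indicator S x"
          by (intro tendsto_add tendsto_mult tendsto_const LIMSEQ_Suc[OF lim_1_over_n])
        then have "(\<lambda>m. F m x) \<longlonglongrightarrow> f x"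
          by (simp add: F_def)
        then show "(\<lambda>m. F m x powr p) \<longlonglongrightarrow> f x powr p"
          using p F_nonneg by (intro tendsto_powr') auto
      qed
    qed measurable
    then have "(\<lambda>m. ennreal K * (\<integral>\<^sup>+ x. ennreal (F m x powr p * w x) \<partial>lebesgue))
        \<longlonglongrightarrow> ennreal K * (\<integral>\<^sup>+ x. ennreal (f x powr p * w x) \<partial>lebesgue)"
      by (intro ennreal_tendsto_cmult) auto
    ultimately show ?thesis
      by (intro LIMSEQ_le_const) auto
  qed
  with K show ?thesis
    by (rule that)
qed

text \<open>On the cube itself the maximal function is at least the average over the cube.\<close>

lemma cube_avg_powr_le_MLp_pow:
  assumes "0 < l"
  shows "epowr (cube_avg f a l) p * (\<integral>\<^sup>+ x \<in> cube a l. ennreal (w x) \<partial>lebesgue) \<le> MLp_pow p w f"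
proof -
  have "epowr (cube_avg f a l) p * (\<integral>\<^sup>+ x \<in> cube a l. ennreal (w x) \<partial>lebesgue)
      = (\<integral>\<^sup>+ x. epowr (cube_avg f a l) p * (ennreal (w x) * indicator (cube a l) x) \<partial>lebesgue)"
    by (rule nn_integral_cmult[symmetric]) measurable
  also have "\<dots> \<le> MLp_pow p w f"
    unfolding MLp_pow_def
  proof (rule nn_integral_mono)
    fix x
    show "epowr (cube_avg f a l) p * (ennreal (w x) * indicator (cube a l) x) \<le> epowr (maximal f x) p * ennreal (w x)"
    proof (cases "x \<in> cube a l")
      case True
      then show ?thesis
        using assms p by (auto intro!: mult_right_mono epowr_mono cube_avg_le_maximal)
    qed simp
  qed
  finally show ?thesis .
qed

text \<open>Bounded measurable functions are limits almost everywhere of continuous ones.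
  Restricting to one cube beforehand leaves just two integrals, both of which converge by dominated
  convergence.\<close>

lemma testing_inequality:
  obtains K where "0 < K"
    "\<And>f a l B. \<lbrakk>0 < l; f \<in> borel_measurable lebesgue; \<And>x. 0 \<le> f x; \<And>x. f x \<le> B; \<And>x. x \<notin> cube a l \<Longrightarrow> f x = 0\<rbrakk> \<Longrightarrow>
      ((\<integral>x. f x \<partial>lebesgue) / l ^ DIM('a)) powr p * (LINT x:cube a l|lebesgue. w x)
        \<le> K * (\<integral>x. f x powr p * w x \<partial>lebesgue)"
proof -
  obtain K where K: "0 < K" and strong:
    "\<And>f. \<lbrakk>continuous_on UNIV f; bounded {x. f x \<noteq> 0}; \<And>x. 0 \<le> f x\<rbrakk> \<Longrightarrow>
      MLp_pow p w f \<le> ennreal K * (\<integral>\<^sup>+ x. ennreal (f x powr p * w x) \<partial>lebesgue)"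
    using strong_type_continuous by blast
  have "((\<integral>x. f x \<partial>lebesgue) / l ^ DIM('a)) powr p * (LINT x:cube a l|lebesgue. w x)
        \<le> K * (\<integral>x. f x powr p * w x \<partial>lebesgue)"
    if l: "0 < l" and f [measurable]: "f \<in> borel_measurable lebesgue" and nonneg: "\<And>x. 0 \<le> f x" and B: "\<And>x. f x \<le> B"
      and supp: "\<And>x. x \<notin> cube a l \<Longrightarrow> f x = 0" for f a l B
  proof -
    let ?Q = "cube a l"
    have "0 \<le> B"
      using nonneg[of 0] B[of 0] by linarith
    have "f measurable_on UNIV"
      using f by (intro lebesgue_measurable_imp_measurable_on_real) auto
    then obtain Z g where Z: "negligible Z" and g: "\<And>n. continuous_on UNIV (g n :: 'a \<Rightarrow> real)"
      "\<And>x. x \<notin> Z \<Longrightarrow> (\<lambda>n. g n x) \<longlonglongrightarrow> f x"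
      unfolding measurable_on_def by auto
    obtain R where R: "\<And>x. x \<in> ?Q \<Longrightarrow> norm x \<le> R"
      using bounded_cube[of a l] by (auto simp: bounded_iff)
    \<comment> \<open>Truncation to [0, B] and a cutoff that is 1 on the ball of radius
      \<open>R\<close> around the origin, which contains the cube: continuity is kept, and uniform
      bounds and a common bounded support are gained.\<close>
    define h where "h n x = max 0 (min B (g n x)) * max 0 (min 1 (R + 1 - norm x))" for n x
    have h_cont: "continuous_on UNIV (h n)" for n
      unfolding h_def[abs_def] by (intro continuous_intros g)
    have h_nonneg: "0 \<le> h n x" for n x
      by (simp add: h_def)
    have h_le: "h n x \<le> B" for n x
    proof -
      have "h n x \<le> B * 1"
        unfolding h_def using \<open>0 \<le> B\<close> by (intro mult_mono) auto
      then show ?thesis by simp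
    qed
    define S where "S = cball (0::'a) (R + 1)"
    have h_supp: "h n x = 0" if "x \<notin> S" for n x
      using that by (simp add: h_def S_def)
    have h_bdd: "bounded {x. h n x \<noteq> 0}" for n
    proof (rule bounded_subset[of S])
      show "{x. h n x \<noteq> 0} \<subseteq> S"
        using h_supp by blast
    qed (simp add: S_def)
    note [measurable] = test_fun_measurable[OF test_fun_continuous[OF h_cont h_bdd]]
    have [measurable]: "S \<in> sets lebesgue"
      by (simp add: S_def)
    have h_lim: "(\<lambda>n. h n x) \<longlonglongrightarrow> f x" if "x \<notin> Z" for x
    proof -
      have "(\<lambda>n. h n x) \<longlonglongrightarrow> max 0 (min B (f x)) * max 0 (min 1 (R + 1 - norm x))"
        unfolding h_def by (intro tendsto_intros g(2) that)
      moreover have "max 0 (min B (f x)) * max 0 (min 1 (R + 1 - norm x)) = f x"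
        using R[of x] supp[of x] nonneg[of x] B[of x] by (cases "x \<in> ?Q") auto
      ultimately show ?thesis by simp
    qed
    have AE_Z: "AE x in lebesgue. x \<notin> Z"
      using Z by (simp add: negligible_iff_null_sets AE_not_in)
    define W where "W = (LINT x:?Q|lebesgue. w x)"
    have W_eq: "(\<integral>\<^sup>+ x \<in> ?Q. ennreal (w x) \<partial>lebesgue) = ennreal W"
    proof -
      have "(\<integral>\<^sup>+ x \<in> ?Q. ennreal (w x) \<partial>lebesgue) = (\<integral>\<^sup>+ x. ennreal (indicator ?Q x * w x) \<partial>lebesgue)"
        by (intro nn_integral_cong) (simp add: indicator_def)
      also have "\<dots> = ennreal W"
        unfolding W_def set_lebesgue_integral_def using w_nonneg integrable_w_compact[OF compact_cube]
        by (subst nn_integral_eq_integral) auto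
      finally show ?thesis .
    qed
    have "0 \<le> W"
      unfolding W_def set_lebesgue_integral_def using w_nonneg by (intro integral_nonneg_AE) auto
    define r where "r n = (\<integral>x. indicator ?Q x * h n x \<partial>lebesgue) / l ^ DIM('a)" for n
    define I where "I n = (\<integral>x. h n x powr p * w x \<partial>lebesgue)" for n
    have int_Bw: "integrable lebesgue (\<lambda>x. B powr p * (indicator S x * w x))"
      by (intro integrable_mult_right integrable_w_compact) (simp add: S_def)
    have Bw: "norm (h n x powr p * w x) \<le> B powr p * (indicator S x * w x)" for n x
    proof (cases "x \<in> S")
      case True
      then show ?thesis
        using h_nonneg[of n x] h_le[of n x] p w_nonneg[of x]
        by (auto simp: abs_mult intro!: mult_right_mono powr_mono2)
    qed (simp add: h_supp)
    have ineq: "r n powr p * W \<le> K * I n" for n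
    proof -
      have "test_fun (\<lambda>x. indicator ?Q x * h n x)"
        by (rule test_fun_le[OF _ test_fun_continuous[OF h_cont[of n] h_bdd[of n]]]) (measurable, simp add: indicator_def)
      then have "(\<integral>\<^sup>+ x. ennreal (indicator ?Q x * h n x) \<partial>lebesgue) = ennreal (\<integral>x. indicator ?Q x * h n x \<partial>lebesgue)"
        using h_nonneg by (intro nn_integral_eq_integral integrable_test_fun) auto
      moreover have "(\<integral>\<^sup>+ x. ennreal (indicator ?Q x * h n x) \<partial>lebesgue) = (\<integral>\<^sup>+ x \<in> ?Q. ennreal \<bar>h n x\<bar> \<partial>lebesgue)"
        using h_nonneg by (intro nn_integral_cong) (simp add: indicator_def)
      moreover have rn: "0 \<le> (\<integral>x. indicator ?Q x * h n x \<partial>lebesgue)"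
        using h_nonneg by (intro integral_nonneg_AE) auto
      ultimately have "cube_avg (h n) a l = ennreal (r n)"
        unfolding cube_avg_def r_def using l by (simp add: ennreal_mult[symmetric])
      moreover have "0 \<le> r n"
        using rn l by (simp add: r_def)
      moreover have "integrable lebesgue (\<lambda>x. h n x powr p * w x)"
        by (rule Bochner_Integration.integrable_bound[OF int_Bw]) (measurable, use Bw in \<open>auto intro: order_trans[OF _ abs_ge_self]\<close>)
      then have "(\<integral>\<^sup>+ x. ennreal (h n x powr p * w x) \<partial>lebesgue) = ennreal (I n)"
        unfolding I_def using w_nonneg by (intro nn_integral_eq_integral) auto
      moreover have "0 \<le> I n"
        unfolding I_def using w_nonneg by (intro integral_nonneg_AE) auto
      moreover have "epowr (cube_avg (h n) a l) p * (\<integral>\<^sup>+ x \<in> ?Q. ennreal (w x) \<partial>lebesgue)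
          \<le> ennreal K * (\<integral>\<^sup>+ x. ennreal (h n x powr p * w x) \<partial>lebesgue)"
        using cube_avg_powr_le_MLp_pow[OF l] strong[OF h_cont h_bdd h_nonneg] by (rule order_trans)
      ultimately have "ennreal (r n powr p * W) \<le> ennreal (K * I n)"
        unfolding W_eq using K \<open>0 \<le> W\<close> by (simp add: ennreal_mult)
      then show ?thesis
        using K \<open>0 \<le> I n\<close> by (subst (asm) ennreal_le_iff) auto
    qed
    have "(\<lambda>n. \<integral>x. indicator ?Q x * h n x \<partial>lebesgue) \<longlonglongrightarrow> (\<integral>x. f x \<partial>lebesgue)"
    proof (rule integral_dominated_convergence[where w="\<lambda>x. B * indicator ?Q x"])
      show "integrable lebesgue (\<lambda>x. B * indicator ?Q x)"
        by (intro integrable_test_fun test_fun_cmult test_fun_indicator) (auto simp: bounded_cube)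
      show "AE x in lebesgue. (\<lambda>n. indicator ?Q x * h n x) \<longlonglongrightarrow> f x"
        using AE_Z
      proof eventually_elim
        case (elim x)
        show ?case
          using h_lim[OF elim] supp[of x] by (cases "x \<in> ?Q") auto
      qed
      show "AE x in lebesgue. norm (indicator ?Q x * h n x) \<le> B * indicator ?Q x" for n
        using h_nonneg h_le by (intro AE_I2) (simp add: indicator_def)
    qed measurable
    then have r_lim: "r \<longlonglongrightarrow> (\<integral>x. f x \<partial>lebesgue) / l ^ DIM('a)"
      unfolding r_def[abs_def] using l by (intro tendsto_divide tendsto_const) auto
    have "0 \<le> r n" for n
      unfolding r_def using l h_nonneg by (intro divide_nonneg_nonneg integral_nonneg_AE) auto
    then have "(\<lambda>n. r n powr p * W) \<longlonglongrightarrow> ((\<integral>x. f x \<partial>lebesgue) / l ^ DIM('a)) powr p * W"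
      using p by (intro tendsto_mult tendsto_const tendsto_powr' r_lim) auto
    moreover have "I \<longlonglongrightarrow> (\<integral>x. f x powr p * w x \<partial>lebesgue)"
      unfolding I_def[abs_def]
    proof (rule integral_dominated_convergence[OF _ _ int_Bw])
      show "AE x in lebesgue. (\<lambda>n. h n x powr p * w x) \<longlonglongrightarrow> f x powr p * w x"
        using AE_Z
      proof eventually_elim
        case (elim x)
        show ?case
          using h_lim[OF elim] h_nonneg p by (intro tendsto_mult tendsto_const tendsto_powr') auto
      qed
    qed (measurable, use Bw in auto)
    then have "(\<lambda>n. K * I n) \<longlonglongrightarrow> K * (\<integral>x. f x powr p * w x \<partial>lebesgue)"
      by (intro tendsto_mult tendsto_const)
    ultimately show ?thesis
      unfolding W_def[symmetric] using ineq by (intro LIMSEQ_le) auto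
  qed
  with K show ?thesis
    by (rule that)
qed

section \<open>The Muckenhoupt condition\<close>

lemma in_Ap_weight:
  assumes pos: "0 < emeasure lebesgue {x. 0 < w x}"
  shows "in_Ap p w"
proof -
  obtain K where K: "0 < K" and testing:
    "\<And>f a l B. \<lbrakk>0 < l; f \<in> borel_measurable lebesgue; \<And>x. 0 \<le> f x; \<And>x. f x \<le> B; \<And>x. x \<notin> cube a l \<Longrightarrow> f x = 0\<rbrakk> \<Longrightarrow>
      ((\<integral>x. f x \<partial>lebesgue) / l ^ DIM('a)) powr p * (LINT x:cube a l|lebesgue. w x)
        \<le> K * (\<integral>x. f x powr p * w x \<partial>lebesgue)"
    using testing_inequality by blast
  \<comment> \<open>The exponent of the dual weight. The identity s p = s + 1 gives u^(-s p) u =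
    u^(-s), so that both sides of the testing inequality involve the same integral.\<close>
  define s where "s = 1 / (p - 1)"
  have s: "0 < s" "s * p = s + 1"
    using p by (auto simp: s_def field_simps)
  \<comment> \<open>The shift by 1/(j+1) keeps the test function bounded where \<open>w\<close>
    vanishes, so its integral over a cube is finite and may be cancelled.\<close>
  define v where "v j x = (w x + 1 / real (Suc j)) powr (- s)" for j x
  have v_meas [measurable]: "v j \<in> borel_measurable lebesgue" for j
    unfolding v_def[abs_def] by measurable
  have shift_pos: "0 < w x + 1 / real (Suc j)" for j x
    using w_nonneg[of x] by (simp add: add_nonneg_pos del: of_nat_Suc)
  have v_nonneg: "0 \<le> v j x" for j x
    by (simp add: v_def)
  have v_le: "v j x \<le> (1 / real (Suc j)) powr (- s)" for j x
    unfolding v_def using s w_nonneg[of x] by (intro powr_mono2') (auto simp del: of_nat_Suc)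
  have v_mono: "v j x \<le> v k x" if "j \<le> k" for j k x
  proof -
    have "1 / real (Suc k) \<le> 1 / real (Suc j)"
      using that by (intro divide_left_mono) auto
    then show ?thesis
      unfolding v_def using s shift_pos by (intro powr_mono2') (auto simp del: of_nat_Suc)
  qed
  have v_powr: "v j x powr p * w x \<le> v j x" for j x
  proof -
    have "v j x powr p * w x \<le> v j x powr p * (w x + 1 / real (Suc j))"
      by (intro mult_left_mono) auto
    also have "\<dots> = (w x + 1 / real (Suc j)) powr (- s * p) * (w x + 1 / real (Suc j)) powr 1"
      using shift_pos[of x j] by (simp add: v_def powr_powr del: of_nat_Suc)
    also have "\<dots> = v j x"
      unfolding powr_add[symmetric] v_def using s(2) by simp
    finally show ?thesis .
  qed
  define W where "W a l = (LINT x:cube a l|lebesgue. w x)" for a l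
  define J where "J a l j = (\<integral>x. indicator (cube a l) x * v j x \<partial>lebesgue)" for a l j
  have W_nonneg: "0 \<le> W a l" for a l
    unfolding W_def set_lebesgue_integral_def using w_nonneg by (intro integral_nonneg_AE) auto
  have J_nonneg: "0 \<le> J a l j" for a l j
    unfolding J_def using v_nonneg by (intro integral_nonneg_AE) auto
  have test: "test_fun (\<lambda>x. indicator (cube a l) x * v j x)" for a l j
  proof (rule test_fun_le[OF _ test_fun_cmult[OF test_fun_indicator[OF cube_in_lebesgue bounded_cube[of a l]], of "(1 / real (Suc j)) powr (- s)"]])
    fix x
    show "\<bar>indicator (cube a l) x * v j x\<bar> \<le> \<bar>(1 / real (Suc j)) powr (- s) * indicator (cube a l) x\<bar>"
      using v_le[of j x] v_nonneg[of j x] by (simp add: indicator_def del: of_nat_Suc)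
  qed measurable
  have J_nn: "(\<integral>\<^sup>+ x \<in> cube a l. ennreal (v j x) \<partial>lebesgue) = ennreal (J a l j)" for a l j
  proof -
    have "(\<integral>\<^sup>+ x \<in> cube a l. ennreal (v j x) \<partial>lebesgue) = (\<integral>\<^sup>+ x. ennreal (indicator (cube a l) x * v j x) \<partial>lebesgue)"
      by (intro nn_integral_cong) (simp add: indicator_def)
    also have "\<dots> = ennreal (J a l j)"
      unfolding J_def using v_nonneg test by (intro nn_integral_eq_integral integrable_test_fun) auto
    finally show ?thesis .
  qed
  \<comment> \<open>Testing gives p powers of the average of \<open>v j\<close> on the left and one
    integral of \<open>v j\<close> on the right; cancelling one factor leaves p - 1. If the integral
    is 0, the left side is 0 because \<open>0 powr (p - 1) = 0\<close>.\<close>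
  have bound: "W a l / l ^ DIM('a) * (J a l j / l ^ DIM('a)) powr (p - 1) \<le> K" if l: "0 < l" for a l j
  proof (cases "J a l j = 0")
    case True
    then show ?thesis using K by simp
  next
    case False
    then have J: "0 < J a l j"
      using J_nonneg[of a l j] by linarith
    let ?f = "\<lambda>x. indicator (cube a l) x * v j x"
    have "(J a l j / l ^ DIM('a)) powr p * W a l \<le> K * (\<integral>x. ?f x powr p * w x \<partial>lebesgue)"
      unfolding J_def W_def
    proof (rule testing[OF l])
      show "?f x \<le> (1 / real (Suc j)) powr (- s)" for x
        using v_le[of j x] by (simp add: indicator_def del: of_nat_Suc)
    qed (use v_nonneg in auto)
    also have "\<dots> \<le> K * J a l j"
    proof (intro mult_left_mono)
      have le: "?f x powr p * w x \<le> ?f x" for x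
        using v_powr[of j x] p by (simp add: indicator_def)
      have "integrable lebesgue (\<lambda>x. ?f x powr p * w x)"
        by (rule Bochner_Integration.integrable_bound[OF integrable_test_fun[OF test[of a l j]]])
          (measurable, use le v_nonneg w_nonneg in auto)
      then show "(\<integral>x. ?f x powr p * w x \<partial>lebesgue) \<le> J a l j"
        unfolding J_def by (rule integral_mono[OF _ integrable_test_fun[OF test] le])
    qed (use K in simp)
    also have "(J a l j / l ^ DIM('a)) powr p = (J a l j / l ^ DIM('a)) powr (p - 1) * (J a l j / l ^ DIM('a))"
      using J l powr_mult_base[of "J a l j / l ^ DIM('a)" "p - 1"] by (simp add: mult.commute)
    finally have "(W a l / l ^ DIM('a) * (J a l j / l ^ DIM('a)) powr (p - 1)) * J a l j \<le> K * J a l j"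
      by (simp add: ac_simps)
    then show ?thesis
      using J by (rule mult_right_le_imp_le)
  qed
  \<comment> \<open>\<open>v j\<close> increases to the dual weight pointwise, also where w x = 0:
    there it equals (j+1)^s and tends to \<open>top\<close>, the value assigned by
    \<open>dual_weight\<close>.\<close>
  have dual_SUP: "(\<integral>\<^sup>+ x \<in> cube a l. dual_weight p w x \<partial>lebesgue) = (SUP j. ennreal (J a l j))" for a l
  proof -
    have "dual_weight p w x * indicator (cube a l) x = (SUP j. ennreal (v j x) * indicator (cube a l) x)" for x
    proof (cases "x \<in> cube a l")
      case True
      have "(\<lambda>j. ennreal (v j x)) \<longlonglongrightarrow> dual_weight p w x"
      proof (cases "w x = 0")
        case True
        have "filterlim (\<lambda>j. real (Suc j)) at_top sequentially"
          by (rule filterlim_compose[OF filterlim_real_sequentially filterlim_Suc])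
        then have "(\<lambda>j. real (Suc j) powr (- s)) \<longlonglongrightarrow> 0"
          using s by (intro tendsto_neg_powr) auto
        then have "filterlim (\<lambda>j. inverse (real (Suc j) powr (- s))) at_top sequentially"
          by (rule filterlim_inverse_at_top) (simp del: of_nat_Suc)
        moreover have "v j x = inverse (real (Suc j) powr (- s))" for j
          using True by (simp add: v_def powr_minus powr_divide del: of_nat_Suc)
        ultimately show ?thesis
          using True by (simp add: dual_weight_def ennreal_tendsto_top_eq_at_top)
      next
        case False
        then have "0 < w x"
          using w_nonneg[of x] by simp
        have "(\<lambda>j. w x + 1 / real (Suc j)) \<longlonglongrightarrow> w x + 0"
          by (intro tendsto_intros LIMSEQ_Suc[OF lim_1_over_n])
        then have "(\<lambda>j. v j x) \<longlonglongrightarrow> w x powr (- s)"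
          unfolding v_def using \<open>0 < w x\<close> by (intro tendsto_powr) auto
        moreover have "dual_weight p w x = ennreal (w x powr (- s))"
          using False by (simp add: dual_weight_def s_def)
        ultimately show ?thesis
          by (simp only: tendsto_ennrealI)
      qed
      moreover have "(\<lambda>j. ennreal (v j x)) \<longlonglongrightarrow> (SUP j. ennreal (v j x))"
        by (intro LIMSEQ_SUP monoI ennreal_leI v_mono)
      ultimately have "dual_weight p w x = (SUP j. ennreal (v j x))"
        by (rule LIMSEQ_unique)
      then show ?thesis using True by simp
    qed simp
    then have "(\<integral>\<^sup>+ x \<in> cube a l. dual_weight p w x \<partial>lebesgue)
        = (\<integral>\<^sup>+ x. (SUP j. ennreal (v j x) * indicator (cube a l) x) \<partial>lebesgue)"
      by simp
    also have "\<dots> = (SUP j. \<integral>\<^sup>+ x \<in> cube a l. ennreal (v j x) \<partial>lebesgue)"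
      by (rule nn_integral_monotone_convergence_SUP)
        (auto simp: incseq_def le_fun_def indicator_def intro!: ennreal_leI v_mono)
    finally show ?thesis
      by (simp add: J_nn)
  qed
  \<comment> \<open>The bound can be solved for \<open>J\<close> only if the cube has positive
    weight. Arbitrary cubes are then reached by enclosing them in larger ones that do.\<close>
  have dual_finite: "(\<integral>\<^sup>+ x \<in> cube a l. dual_weight p w x \<partial>lebesgue) < top" if l: "0 < l" and W: "0 < W a l" for a l
  proof -
    define r where "r = (K * l ^ DIM('a) / W a l) powr (1 / (p - 1)) * l ^ DIM('a)"
    have "J a l j \<le> r" for j
    proof -
      have "(J a l j / l ^ DIM('a)) powr (p - 1) \<le> K * l ^ DIM('a) / W a l"
        using bound[OF l, of a j] l W by (simp add: field_simps)
      then have "((J a l j / l ^ DIM('a)) powr (p - 1)) powr (1 / (p - 1)) \<le> (K * l ^ DIM('a) / W a l) powr (1 / (p - 1))"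
        using p by (intro powr_mono2) auto
      then have "J a l j / l ^ DIM('a) \<le> (K * l ^ DIM('a) / W a l) powr (1 / (p - 1))"
        using p J_nonneg[of a l j] l by (simp add: powr_powr)
      then show ?thesis
        using l by (simp add: r_def field_simps)
    qed
    then have "(SUP j. ennreal (J a l j)) \<le> ennreal r"
      by (intro SUP_least ennreal_leI)
    also have "\<dots> < top" by simp
    finally show ?thesis by (simp add: dual_SUP)
  qed
  \<comment> \<open>Centred cubes exhausting the space. One of them meets the set where
    \<open>w\<close> is positive in positive measure, and so do all later ones.\<close>
  define Q where "Q m = cube (- real m *\<^sub>R One :: 'a) (2 * real m)" for m :: nat
  have mem_Q: "x \<in> Q m" if "norm x \<le> real m" for x m
  proof -
    have "- real m \<le> x \<bullet> i \<and> x \<bullet> i \<le> real m" if "i \<in> Basis" for i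
      using Basis_le_norm[OF that, of x] \<open>norm x \<le> real m\<close> by linarith
    then show ?thesis
      unfolding Q_def mem_cube inner_scaleR_left by simp
  qed
  have Q_mono: "Q m \<subseteq> Q k" if "m \<le> k" for m k
  proof
    fix x assume x: "x \<in> Q m"
    have "- real k \<le> x \<bullet> i \<and> x \<bullet> i \<le> real k" if "i \<in> Basis" for i
    proof -
      have "- real m \<le> x \<bullet> i \<and> x \<bullet> i \<le> real m"
        using x that unfolding Q_def mem_cube inner_scaleR_left by fastforce
      then show ?thesis using \<open>m \<le> k\<close> by linarith
    qed
    then show "x \<in> Q k"
      unfolding Q_def mem_cube inner_scaleR_left by simp
  qed
  have w_pos_sets: "{x. 0 < w x} \<in> sets lebesgue"
    using borel_measurable_less[OF borel_measurable_const[of 0] w_measurable] by simp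
  obtain m0 where m0: "0 < emeasure lebesgue ({x. 0 < w x} \<inter> Q m0)"
  proof -
    have "{x. 0 < w x} \<subseteq> (\<Union>m. {x. 0 < w x} \<inter> Q m)"
    proof
      fix x assume "x \<in> {x. 0 < w x}"
      moreover obtain m :: nat where "norm x \<le> real m"
        using real_arch_simple by blast
      ultimately show "x \<in> (\<Union>m. {x. 0 < w x} \<inter> Q m)"
        using mem_Q by blast
    qed
    then have eq: "{x. 0 < w x} = (\<Union>m. {x. 0 < w x} \<inter> Q m)"
      by blast
    have "\<exists>m. emeasure lebesgue ({x. 0 < w x} \<inter> Q m) \<noteq> 0"
    proof (rule ccontr)
      assume "\<not> ?thesis"
      then have "emeasure lebesgue {x. 0 < w x} = 0"
        using w_pos_sets by (subst eq, intro emeasure_UN_eq_0) (auto simp: Q_def)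
      with pos show False by simp
    qed
    then show ?thesis
      using that zero_less_iff_neq_zero by blast
  qed
  have W_pos: "0 < W (- real m *\<^sub>R One) (2 * real m)" if "m0 \<le> m" for m
  proof (rule ccontr)
    assume "\<not> ?thesis"
    then have "(\<integral>x. indicator (Q m) x * w x \<partial>lebesgue) = 0"
      using W_nonneg[of "- real m *\<^sub>R One" "2 * real m"] by (simp add: W_def set_lebesgue_integral_def Q_def)
    then have "AE x in lebesgue. indicator (Q m) x * w x = 0"
      using w_nonneg integrable_w_compact[OF compact_cube]
      by (subst (asm) integral_nonneg_eq_0_iff_AE) (auto simp: Q_def)
    then have "AE x in lebesgue. x \<notin> {x. 0 < w x} \<inter> Q m0"
    proof eventually_elim
      case (elim x)
      then show ?case
        using Q_mono[OF that] by (auto simp: indicator_def split: if_splits)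
    qed
    moreover have "{x. 0 < w x} \<inter> Q m0 \<in> sets lebesgue"
      unfolding Q_def by (intro sets.Int w_pos_sets cube_in_lebesgue)
    ultimately have "emeasure lebesgue ({x. 0 < w x} \<inter> Q m0) = 0"
      by (simp only: AE_iff_null_sets[symmetric] null_setsD1)
    with m0 show False by simp
  qed
  have finite: "(\<integral>\<^sup>+ x \<in> cube a l. dual_weight p w x \<partial>lebesgue) < top" for a l
  proof -
    obtain R where R: "\<And>x. x \<in> cube a l \<Longrightarrow> norm x \<le> R"
      using bounded_cube[of a l] by (auto simp: bounded_iff)
    obtain m1 :: nat where "R \<le> real m1"
      using real_arch_simple by blast
    \<comment> \<open>The successor guarantees a positive side length.\<close>
    define m where "m = Suc (max m0 m1)"
    have "cube a l \<subseteq> Q m"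
      using R \<open>R \<le> real m1\<close> by (force simp: m_def intro: mem_Q)
    then have "(\<integral>\<^sup>+ x \<in> cube a l. dual_weight p w x \<partial>lebesgue) \<le> (\<integral>\<^sup>+ x \<in> Q m. dual_weight p w x \<partial>lebesgue)"
      by (intro nn_integral_mono) (auto simp: indicator_def)
    also have "\<dots> < top"
      unfolding Q_def by (intro dual_finite W_pos) (auto simp: m_def)
    finally show ?thesis .
  qed
  have "W a l / l ^ DIM('a) * (enn2real (\<integral>\<^sup>+ x \<in> cube a l. dual_weight p w x \<partial>lebesgue) / l ^ DIM('a)) powr (p - 1) \<le> K"
    if l: "0 < l" for a l
  proof -
    obtain d where d: "(\<integral>\<^sup>+ x \<in> cube a l. dual_weight p w x \<partial>lebesgue) = ennreal d" "0 \<le> d"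
      using finite[of a l] by (cases "\<integral>\<^sup>+ x \<in> cube a l. dual_weight p w x \<partial>lebesgue") auto
    have "J a l j \<le> J a l k" if "j \<le> k" for j k
      unfolding J_def using v_mono[OF that] test
      by (intro integral_mono integrable_test_fun) (auto simp: indicator_def)
    then have "(\<lambda>j. ennreal (J a l j)) \<longlonglongrightarrow> ennreal d"
      unfolding d(1)[symmetric] dual_SUP by (intro LIMSEQ_SUP monoI ennreal_leI)
    then have "J a l \<longlonglongrightarrow> d"
      using d(2) J_nonneg by (subst (asm) tendsto_ennreal_iff) auto
    then have "(\<lambda>j. W a l / l ^ DIM('a) * (J a l j / l ^ DIM('a)) powr (p - 1))
        \<longlonglongrightarrow> W a l / l ^ DIM('a) * (d / l ^ DIM('a)) powr (p - 1)"
      using p l J_nonneg by (intro tendsto_mult tendsto_const tendsto_powr' tendsto_divide) auto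
    then have "W a l / l ^ DIM('a) * (d / l ^ DIM('a)) powr (p - 1) \<le> K"
      using bound[OF l] by (intro LIMSEQ_le_const2) auto
    then show ?thesis
      using d by simp
  qed
  with finite show ?thesis
    using Np unfolding in_Ap_def W_def in_Np_def by (auto intro!: exI[of _ K])
qed

end

theorem theorem3p7:
  fixes T :: "('a::euclidean_space \<Rightarrow> real) \<Rightarrow> ('a \<Rightarrow> real)"
    and w :: "'a \<Rightarrow> real" and p :: real
  assumes "p > 1"
    and "linear_op T"
    and "non_degenerate T"
    and "Lp_bounded p T"
    and "in_Np p w"
    and "emeasure lebesgue {x. w x > 0} > 0"
    and "\<exists>C::real. C > 0 \<and> (\<forall>f. in_MLp p w f \<longrightarrow>
           MLp_pow p w (T f) \<le> ennreal (C powr p) * MLp_pow p w f)"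
  shows "in_Ap p w"
proof -
  obtain C where C: "0 < C" "\<And>f. in_MLp p w f \<Longrightarrow> MLp_pow p w (T f) \<le> ennreal (C powr p) * MLp_pow p w f"
    using assms(7) by blast
  \<comment> \<open>Measurability of \<open>T f\<close> is part of boundedness on L^p.\<close>
  have T_measurable: "T f \<in> borel_measurable lebesgue" if "test_fun f" for f
    using assms(1,4) in_Lp_test_fun[OF that, of p] unfolding Lp_bounded_def by auto
  have in_MLp: "in_MLp p w f" if "test_fun f" for f
    using MLp_pow_test_fun_finite[OF that assms(5)] test_fun_measurable[OF that] assms(1)
    by (simp add: in_MLp_def)
  obtain c0 where "0 < c0" and c0: "\<forall>l>0. \<exists>xl. \<forall>a f x.
     loc_integrable f \<longrightarrow> (\<forall>y. f y \<ge> 0) \<longrightarrow>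
     x \<in> ((\<lambda>y. y + xl) ` cube a l) \<union> ((\<lambda>y. y - xl) ` cube a l) \<longrightarrow>
     (LINT y:cube a l|lebesgue. f y) / l ^ DIM('a)
       \<le> c0 * \<bar>T (\<lambda>y. indicator (cube a l) y * f y) x\<bar>"
    using assms(3) unfolding non_degenerate_def by blast
  have minus: "(\<lambda>y. y - v) ` cube a l = cube (a - v) l" for a v :: 'a and l
    using cube_translate[of "- v" a l] by simp
  \<comment> \<open>The vector is quantified before \<open>a\<close> and \<open>f\<close>, so choice
    yields a function of the side length alone.\<close>
  from c0 obtain X where X: "\<forall>l>0. \<forall>a f x.
     loc_integrable f \<longrightarrow> (\<forall>y. f y \<ge> 0) \<longrightarrow>
     x \<in> cube (a + X l) l \<union> cube (a - X l) l \<longrightarrow>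
     (LINT y:cube a l|lebesgue. f y) / l ^ DIM('a)
       \<le> c0 * \<bar>T (\<lambda>y. indicator (cube a l) y * f y) x\<bar>"
    unfolding cube_translate minus by metis
  interpret MLp_bounded_nondegenerate T w p C c0 X
    by unfold_locales (use assms C T_measurable in_MLp \<open>0 < c0\<close> X in auto)
  show ?thesis
    using assms(6) by (rule in_Ap_weight)
qed

end
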